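(* Let $k\ge 0$ be an integer. Suppose $(\mathbf q_h,u_h,\lambda_h)\in\mathcal M_h\times\Lambda_h$, with $\mathbf q_h=\{\mathbf q_0,\mathbf q_b\}$, is a solution of the hybridized WG-MFEM scheme, i.e. $\lambda_h=Q_bg$ on $\partial\Omega$ and $$s_T(\mathbf q_h,\mathbf v)+(\alpha\mathbf q_0,\mathbf v_0)_T-(\nabla_w\cdot\mathbf v,u_h)_T=-\langle\lambda_h,\mathbf v_b\cdot\mathbf n\rangle_{\partial T}\quad\forall\,\mathbf v\in V_k(T),\ T\in\mathcal T_h,$$ $$(\nabla_w\cdot\mathbf q_h,w)_T=(f,w)_T\quad\forall\, w\in W_{k+1}(T),\ T\in\mathcal T_h,$$ $$\sum_{T\in\mathcal T_h}\langle\mathbf q_b\cdot\mathbf n,\phi\rangle_{\partial T}=0\quad\forall\,\phi\in\Lambda_h^0.$$ Then $\lambda_h$ is a solution of the following problem: find $\lambda_h\in\Lambda_h$ satisfying $\lambda_h=Q_bg$ on $\partial\Omega$ and $$\sum_{T\in\mathcal T_h}\left\{s_T(\mathbb H_{\mathbf q}(\lambda_h),\mathbb H_{\mathbf q}(\phi))+(\alpha\,\mathbb H_0(\lambda_h),\mathbb H_0(\phi))_T\right\}=(f,\mathbb H_u(\phi))\qquad\forall\,\phi\in\Lambda_h^0.$$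
   Context: Domain and data: $\Omega\subset\mathbb R^d$ ($d=2,3$) is an open bounded polygonal or polyhedral domain (connected); $\alpha\in[L^\infty(\Omega)]^{d\times d}$ is a symmetric, uniformly positive definite matrix function; $f\in L^2(\Omega)$ and $g\in L^2(\partial\Omega)$ are given. The underlying problem is $\alpha\mathbf q+\nabla u=0$, $\nabla\cdot\mathbf q=f$ in $\Omega$, $u=g$ on $\partial\Omega$. Here $(\cdot,\cdot)_D$ and $\langle\cdot,\cdot\rangle_{\partial D}$ are the $L^2$ inner products on $D$ and $\partial D$, and $(\cdot,\cdot)=(\cdot,\cdot)_\Omega$. Mesh: $\mathcal T_h$ is a finite partition of $\Omega$ into polygons ($d=2$) or polyhedra ($d=3$), with $h_T$ the diameter of $T$, $h=\max_T h_T$; $\mathcal E_h$ is the set of all edges/flat faces, $\mathcal E_h^0=\mathcal E_h\setminus\partial\Omega$ the set of interior ones. $\mathbf n$ is the outward unit normal on $\partial T$. $P_r(D)$ denotes polynomials of degree at most $r$ on $D$. The partition is shape regular: (A1) there are $\rho_v,\rho_e>0$ with $\rho_v h_T^d\le|T|$ and $\rho_e h_e^{d-1}\le|e|$ for all $T\in\mathcal T_h$, $e\in\mathcal E_h$ ($h_e$ the diameter of $e$); (A2) there is $\kappa>0$ with $\kappa h_T\le h_e$ for each edge/face $e\subset\partial T$; (A3) edges/faces are flat, and for each $T$ and each $e\subset\partial T$ there is a pyramid contained in $T$ with base $e$, apex $A_e\in T$ and height $\sigma_e h_T$, $\sigma_e\ge\sigma^*>0$ for a fixed $\sigma^*$,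 such that for every $x_e\in e$ the angle between $x_e-A_e$ and the outward normal of $e$ lies in $[0,\theta_0]$ for a fixed $\theta_0<\pi/2$; (A4) each $T$ has a shape-regular circumscribed simplex $S(T)$ with diameter at most $\gamma_* h_T$ ($\gamma_*$ independent of $T$), and each $S(T)$ intersects at most a fixed finite number of the simplices of the other elements. Spaces: $W_{k+1}(T)=P_{k+1}(T)$; $V_k(T)=\{\mathbf v=\{\mathbf v_0,\mathbf v_b\}:\ \mathbf v_0\in[P_k(T)]^d,\ \mathbf v_b|_e=v_b\mathbf n,\ v_b\in P_k(e),\ e\subset\partial T\}$ ($\mathbf v_b$ is independent of the trace of $\mathbf v_0$); $\mathcal M_h=\bigotimes_{T\in\mathcal T_h}V_k(T)\times W_{k+1}(T)$ (no continuity between elements; $\mathbf v_b$ may take different values from the two sides of an interior edge/face); $\Lambda_h=\{\lambda:\lambda|_e\in P_k(e)\ \forall e\in\mathcal E_h\}$ (single-valued on each $e$); $\Lambda_h^0=\{\lambda\in\Lambda_h:\lambda|_e=0\ \forall e\subset\partial\Omega\}$. $(Q_bg)|_e\in P_k(e)$ is the $L^2(e)$ projection of $g$ on each $e\subset\partial\Omega$. Discrete weak divergence: for $\mathbf v\in V_k(T)$, $\nabla_w\cdot\mathbf v\in P_{k+1}(T)$ is the unique polynomial with $(\nabla_w\cdot\mathbf v,\varphi)_T=-(\mathbf v_0,\nabla\varphi)_T+\langle\mathbf v_b\cdot\mathbf n,\varphi\rangle_{\partial T}$ for all $\varphi\in P_{k+1}(T)$. Stabilizer: $s_T(\mathbf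 r,\mathbf v)=h_T\langle(\mathbf r_0-\mathbf r_b)\cdot\mathbf n,(\mathbf v_0-\mathbf v_b)\cdot\mathbf n\rangle_{\partial T}$ for $\mathbf r,\mathbf v\in V_k(T)$. Operator $\mathbb H$: for $\theta\in\Lambda_h$, let $\{\mathbf q_h^\theta,u_h^\theta\}\in\mathcal M_h$, $\mathbf q_h^\theta=\{\mathbf q_0^\theta,\mathbf q_b^\theta\}$, be the unique solution of the local problems, for every $T\in\mathcal T_h$, $s_T(\mathbf q_h^\theta,\mathbf v)+(\alpha\mathbf q_0^\theta,\mathbf v_0)_T-(\nabla_w\cdot\mathbf v,u_h^\theta)_T=-\langle\theta,\mathbf v_b\cdot\mathbf n\rangle_{\partial T}$ for all $\mathbf v\in V_k(T)$, and $(\nabla_w\cdot\mathbf q_h^\theta,w)_T=0$ for all $w\in W_{k+1}(T)$. Set $\mathbb H_0(\theta)=\mathbf q_0^\theta$, $\mathbb H_b(\theta)=\mathbf q_b^\theta$, $\mathbb H_u(\theta)=u_h^\theta$, and $\mathbb H_{\mathbf q}=\{\mathbb H_0,\mathbb H_b\}$; these are linear operators on $\Lambda_h$. *)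

theory Defs
  imports "HOL-Analysis.Analysis"
begin

section \<open>Polygons, polyhedra and polygonal domains\<close>

text \<open>
  A closed, possibly nonconvex, polygon/polyhedron of dimension \<open>m\<close>, with connected relative
  interior.  With \<open>m = d\<close> these are the mesh elements, with \<open>m = d - 1\<close> the flat edges/faces
  (for \<open>m = 1\<close> just the segments).
\<close>

definition polytopal :: "int \<Rightarrow> (real^'n) set \<Rightarrow> bool" where
  "polytopal m S \<longleftrightarrow>
     aff_dim S = m \<and> connected (rel_interior S) \<and>
     (\<exists>P. finite P \<and> (\<forall>p\<in>P. polytope p \<and> aff_dim p = m) \<and> S = \<Union>P)"

definition polygonal_domain :: "(real^'n) set \<Rightarrow> bool" where
  "polygonal_domain \<Omega> \<longleftrightarrow>
     open \<Omega> \<and> bounded \<Omega> \<and> connected \<Omega> \<and> \<Omega> \<noteq> {} \<and>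
     (\<exists>P. finite P \<and> (\<forall>p\<in>P. polytope p \<and> aff_dim p = int CARD('n) - 1) \<and> frontier \<Omega> = \<Union>P)"

section \<open>Integration on elements and on flat faces\<close>

text \<open>
  The \<open>(d-1)\<close>-dimensional Lebesgue measure on a flat face \<open>e\<close>: Lebesgue measure on the slab of
  thickness 1 over \<open>e\<close> (symmetric about the hyperplane of \<open>e\<close>), pushed forward along the orthogonal
  projection onto that hyperplane.  It is a measure on the whole space that is concentrated on \<open>e\<close>.
\<close>

definition face_measure :: "(real^'n) set \<Rightarrow> (real^'n) measure" where
  "face_measure e =
     completion (distr
       (lebesgue_on {y. closest_point (affine hull e) y \<in> e \<and>
                        dist y (closest_point (affine hull e) y) \<le> 1/2})
       borel (closest_point (affine hull e)))"

definition square_integrable :: "'a measure \<Rightarrow> ('a \<Rightarrow> real) \<Rightarrow> bool" where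
  "square_integrable M f \<longleftrightarrow> f \<in> borel_measurable M \<and> integrable M (\<lambda>x. (f x)\<^sup>2)"

definition ip :: "(real^'n) set \<Rightarrow> (real^'n \<Rightarrow> real) \<Rightarrow> (real^'n \<Rightarrow> real) \<Rightarrow> real" where
  "ip D f g = (LINT x:D|lebesgue. f x * g x)"

definition ipv :: "(real^'n) set \<Rightarrow> (real^'n \<Rightarrow> real^'n) \<Rightarrow> (real^'n \<Rightarrow> real^'n) \<Rightarrow> real" where
  "ipv D f g = (LINT x:D|lebesgue. f x \<bullet> g x)"

section \<open>Coefficient matrix\<close>

definition admissible_coefficient :: "(real^'n) set \<Rightarrow> (real^'n \<Rightarrow> real^'n^'n) \<Rightarrow> bool" where
  "admissible_coefficient \<Omega> \<alpha> \<longleftrightarrow>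
     \<alpha> \<in> borel_measurable (lebesgue_on \<Omega>) \<and>
     (\<exists>C. AE x in lebesgue_on \<Omega>. norm (\<alpha> x) \<le> C) \<and>
     (AE x in lebesgue_on \<Omega>. transpose (\<alpha> x) = \<alpha> x) \<and>
     (\<exists>c>0. AE x in lebesgue_on \<Omega>. \<forall>\<xi>. c * (norm \<xi>)\<^sup>2 \<le> \<xi> \<bullet> (\<alpha> x *v \<xi>))"

section \<open>Meshes\<close>

text \<open>Elements are closed sets.  The edge/face set \<open>Eh\<close> is part of the data, so that hanging nodes
  may be regarded as vertices.\<close>

definition faces :: "(real^'n) set set \<Rightarrow> (real^'n) set \<Rightarrow> (real^'n) set set" where
  "faces Eh T = {e \<in> Eh. e \<subseteq> frontier T}"

definition is_outward_normal :: "(real^'n) set \<Rightarrow> (real^'n) set \<Rightarrow> real^'n \<Rightarrow> bool" where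
  "is_outward_normal T e n \<longleftrightarrow>
     norm n = 1 \<and> (\<forall>x\<in>e. \<forall>y\<in>e. (x - y) \<bullet> n = 0) \<and>
     (\<forall>x\<in>rel_interior e. \<exists>\<epsilon>>0. \<forall>t. 0 < t \<and> t < \<epsilon> \<longrightarrow>
        x - t *\<^sub>R n \<in> interior T \<and> x + t *\<^sub>R n \<notin> T)"

definition outward_normal :: "(real^'n) set \<Rightarrow> (real^'n) set \<Rightarrow> real^'n" where
  "outward_normal T e = (THE n. is_outward_normal T e n)"

text \<open>The last condition makes \<open>outward_normal\<close> meaningful: each \<open>T\<close> lies on one side of each of its
  faces.\<close>

definition polytopal_mesh ::
  "(real^'n) set \<Rightarrow> (real^'n) set set \<Rightarrow> (real^'n) set set \<Rightarrow> bool" where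
  "polytopal_mesh \<Omega> Th Eh \<longleftrightarrow>
     finite Th \<and> (\<forall>T\<in>Th. polytopal (int CARD('n)) T \<and> interior T \<subseteq> \<Omega>) \<and>
     pairwise (\<lambda>T T'. interior T \<inter> interior T' = {}) Th \<and>
     \<Union>Th = closure \<Omega> \<and>
     finite Eh \<and> (\<forall>e\<in>Eh. polytopal (int CARD('n) - 1) e) \<and>
     pairwise (\<lambda>e e'. rel_interior e \<inter> rel_interior e' = {}) Eh \<and>
     (\<forall>e\<in>Eh. \<exists>T\<in>Th. e \<subseteq> frontier T) \<and>
     (\<forall>T\<in>Th. frontier T = \<Union>(faces Eh T)) \<and>
     frontier \<Omega> = \<Union>{e \<in> Eh. e \<subseteq> frontier \<Omega>} \<and>
     (\<forall>T\<in>Th. \<forall>e\<in>faces Eh T. \<exists>n. is_outward_normal T e n)"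

text \<open>The constants are those of the given mesh.  The union of segments is the pyramid with base \<open>e\<close>
  and apex \<open>A\<close>; \<open>S T\<close> is the simplex circumscribed about \<open>T\<close>, whose shape regularity is measured by an
  inscribed ball.\<close>

definition shape_regular :: "(real^'n) set set \<Rightarrow> (real^'n) set set \<Rightarrow> bool" where
  "shape_regular Th Eh \<longleftrightarrow>
     (\<exists>\<rho>v>0. \<exists>\<rho>e>0.
        (\<forall>T\<in>Th. \<rho>v * diameter T ^ CARD('n) \<le> measure lebesgue T) \<and>
        (\<forall>e\<in>Eh. \<rho>e * diameter e ^ (CARD('n) - 1) \<le> measure (face_measure e) e)) \<and>
     (\<exists>\<kappa>>0. \<forall>T\<in>Th. \<forall>e\<in>faces Eh T. \<kappa> * diameter T \<le> diameter e) \<and>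
     (\<exists>\<sigma>>0. \<exists>\<theta>\<^sub>0. 0 \<le> \<theta>\<^sub>0 \<and> \<theta>\<^sub>0 < pi / 2 \<and>
        (\<forall>T\<in>Th. \<forall>e\<in>faces Eh T. \<exists>A\<in>T. \<exists>\<sigma>\<^sub>e\<ge>\<sigma>.
           (\<Union>x\<in>e. closed_segment A x) \<subseteq> T \<and>
           infdist A (affine hull e) = \<sigma>\<^sub>e * diameter T \<and>
           (\<forall>x\<in>e. arccos (((x - A) \<bullet> outward_normal T e) / norm (x - A)) \<in> {0..\<theta>\<^sub>0}))) \<and>
     (\<exists>S :: (real^'n) set \<Rightarrow> (real^'n) set. \<exists>\<gamma>. \<exists>\<rho>>0. \<exists>N :: nat. \<forall>T\<in>Th.
        int CARD('n) simplex S T \<and> T \<subseteq> S T \<and>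
        (\<exists>z r. cball z r \<subseteq> S T \<and> \<rho> * diameter (S T) \<le> r) \<and>
        diameter (S T) \<le> \<gamma> * diameter T \<and>
        card {T' \<in> Th. S T \<inter> S T' \<noteq> {}} \<le> N)"

section \<open>Discrete spaces\<close>

text \<open>
  Polynomials of total degree at most \<open>r\<close> on \<open>D\<close>, as functions that vanish outside \<open>D\<close> (so that a
  function on \<open>D\<close> has exactly one representative).  For a flat face \<open>e\<close> the restrictions to \<open>e\<close> of
  polynomials in \<open>d\<close> variables are the polynomials in \<open>d - 1\<close> local coordinates.
\<close>

definition polys :: "nat \<Rightarrow> (real^'n) set \<Rightarrow> (real^'n \<Rightarrow> real) set" where
  "polys r D =
     {p. \<exists>c :: ('n \<Rightarrow> nat) \<Rightarrow> real.
        p = (\<lambda>x. if x \<in> D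
                 then \<Sum>m | (\<Sum>i\<in>UNIV. m i) \<le> r. c m * (\<Prod>i\<in>UNIV. (x $ i) ^ m i)
                 else 0)}"

text \<open>A weak vector field \<open>{v\<^sub>0, v\<^sub>b}\<close> on an element; \<open>v\<^sub>b\<close> is a family indexed by the faces.\<close>

type_synonym 'n weak_field =
  "(real^'n \<Rightarrow> real^'n) \<times> ((real^'n) set \<Rightarrow> real^'n \<Rightarrow> real^'n)"

definition W_space :: "nat \<Rightarrow> (real^'n) set \<Rightarrow> (real^'n \<Rightarrow> real) set" where
  "W_space k T = polys (k + 1) T"

definition V_space ::
  "(real^'n) set set \<Rightarrow> nat \<Rightarrow> (real^'n) set \<Rightarrow> ('n::finite) weak_field set" where
  "V_space Eh k T =
     {(v0, vb). (\<forall>i. (\<lambda>x. v0 x $ i) \<in> polys k T) \<and>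
        (\<forall>e\<in>faces Eh T. \<exists>w\<in>polys k e. vb e = (\<lambda>x. w x *\<^sub>R outward_normal T e)) \<and>
        (\<forall>e. e \<notin> faces Eh T \<longrightarrow> vb e = (\<lambda>x. 0))}"

definition M_space ::
  "(real^'n) set set \<Rightarrow> (real^'n) set set \<Rightarrow> nat \<Rightarrow>
   (((real^'n) set \<Rightarrow> ('n::finite) weak_field) \<times> ((real^'n) set \<Rightarrow> real^'n \<Rightarrow> real)) set" where
  "M_space Th Eh k = {(q, u). \<forall>T\<in>Th. q T \<in> V_space Eh k T \<and> u T \<in> W_space k T}"

definition Lambda_space ::
  "(real^'n) set set \<Rightarrow> nat \<Rightarrow> ((real^'n) set \<Rightarrow> real^'n \<Rightarrow> real) set" where
  "Lambda_space Eh k =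
     {lam. (\<forall>e\<in>Eh. lam e \<in> polys k e) \<and> (\<forall>e. e \<notin> Eh \<longrightarrow> lam e = (\<lambda>x. 0))}"

definition Lambda0_space ::
  "(real^'n) set \<Rightarrow> (real^'n) set set \<Rightarrow> nat \<Rightarrow> ((real^'n) set \<Rightarrow> real^'n \<Rightarrow> real) set" where
  "Lambda0_space \<Omega> Eh k =
     {lam \<in> Lambda_space Eh k. \<forall>e\<in>Eh. e \<subseteq> frontier \<Omega> \<longrightarrow> lam e = (\<lambda>x. 0)}"

definition Qb :: "nat \<Rightarrow> (real^'n \<Rightarrow> real) \<Rightarrow> (real^'n) set \<Rightarrow> real^'n \<Rightarrow> real" where
  "Qb k g e =
     (THE p. p \<in> polys k e \<and> (\<forall>w\<in>polys k e. (LINT x|face_measure e. (g x - p x) * w x) = 0))"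

section \<open>Weak divergence and stabilizer\<close>

text \<open>\<open>\<langle>a, b\<rangle>\<close> on the boundary of \<open>T\<close>, for functions given face by face.\<close>

definition bip ::
  "(real^'n) set set \<Rightarrow> (real^'n) set \<Rightarrow>
   ((real^'n) set \<Rightarrow> real^'n \<Rightarrow> real) \<Rightarrow> ((real^'n) set \<Rightarrow> real^'n \<Rightarrow> real) \<Rightarrow> real" where
  "bip Eh T a b = (\<Sum>e\<in>faces Eh T. LINT x|face_measure e. a e x * b e x)"

definition grad :: "(real^'n \<Rightarrow> real) \<Rightarrow> real^'n \<Rightarrow> real^'n" where
  "grad \<phi> x = (THE D. GDERIV \<phi> x :> D)"

definition normal_trace ::
  "(real^'n) set \<Rightarrow> ('n::finite) weak_field \<Rightarrow> (real^'n) set \<Rightarrow> real^'n \<Rightarrow> real" where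
  "normal_trace T v e x = snd v e x \<bullet> outward_normal T e"

definition weak_div ::
  "(real^'n) set set \<Rightarrow> nat \<Rightarrow> (real^'n) set \<Rightarrow> ('n::finite) weak_field \<Rightarrow> real^'n \<Rightarrow> real" where
  "weak_div Eh k T v =
     (THE p. p \<in> polys (k + 1) T \<and>
        (\<forall>\<phi>\<in>polys (k + 1) T.
           ip T p \<phi> = - ipv T (fst v) (grad \<phi>) + bip Eh T (normal_trace T v) (\<lambda>e. \<phi>)))"

definition stab ::
  "(real^'n) set set \<Rightarrow> (real^'n) set \<Rightarrow> ('n::finite) weak_field \<Rightarrow> 'n weak_field \<Rightarrow> real" where
  "stab Eh T r v =
     diameter T *
     bip Eh T (\<lambda>e x. (fst r x - snd r e x) \<bullet> outward_normal T e)
              (\<lambda>e x. (fst v x - snd v e x) \<bullet> outward_normal T e)"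

section \<open>Local problems and their solution operator\<close>

definition flux_equation ::
  "(real^'n) set set \<Rightarrow> nat \<Rightarrow> (real^'n \<Rightarrow> real^'n^'n) \<Rightarrow> (real^'n) set \<Rightarrow>
   ((real^'n) set \<Rightarrow> real^'n \<Rightarrow> real) \<Rightarrow> ('n::finite) weak_field \<Rightarrow> (real^'n \<Rightarrow> real) \<Rightarrow> bool" where
  "flux_equation Eh k \<alpha> T \<theta> q u \<longleftrightarrow>
     (\<forall>v\<in>V_space Eh k T.
        stab Eh T q v + ipv T (\<lambda>x. \<alpha> x *v fst q x) (fst v) - ip T (weak_div Eh k T v) u
          = - bip Eh T \<theta> (normal_trace T v))"

definition H_local ::
  "(real^'n) set set \<Rightarrow> nat \<Rightarrow> (real^'n \<Rightarrow> real^'n^'n) \<Rightarrow>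
   ((real^'n) set \<Rightarrow> real^'n \<Rightarrow> real) \<Rightarrow> (real^'n) set \<Rightarrow>
   ('n::finite) weak_field \<times> (real^'n \<Rightarrow> real)" where
  "H_local Eh k \<alpha> \<theta> T =
     (THE (q, u). q \<in> V_space Eh k T \<and> u \<in> W_space k T \<and>
        flux_equation Eh k \<alpha> T \<theta> q u \<and>
        (\<forall>w\<in>W_space k T. ip T (weak_div Eh k T q) w = 0))"

definition Hq where "Hq Eh k \<alpha> \<theta> T = fst (H_local Eh k \<alpha> \<theta> T)"
definition H0 where "H0 Eh k \<alpha> \<theta> T = fst (Hq Eh k \<alpha> \<theta> T)"
definition Hu where "Hu Eh k \<alpha> \<theta> T = snd (H_local Eh k \<alpha> \<theta> T)"

text \<open>The function on \<open>\<Omega>\<close> given by a family of functions on the elements, each vanishing outside its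
  element.  On the skeleton, a null set, several terms may contribute.\<close>

definition broken :: "(real^'n) set set \<Rightarrow> ((real^'n) set \<Rightarrow> real^'n \<Rightarrow> real) \<Rightarrow> real^'n \<Rightarrow> real" where
  "broken Th u x = (\<Sum>T\<in>Th. u T x)"

section \<open>The two problems\<close>

definition hybridized_wg_solution ::
  "(real^'n) set \<Rightarrow> (real^'n) set set \<Rightarrow> (real^'n) set set \<Rightarrow> nat \<Rightarrow> (real^'n \<Rightarrow> real^'n^'n) \<Rightarrow>
   (real^'n \<Rightarrow> real) \<Rightarrow> (real^'n \<Rightarrow> real) \<Rightarrow>
   ((real^'n) set \<Rightarrow> ('n::finite) weak_field) \<Rightarrow> ((real^'n) set \<Rightarrow> real^'n \<Rightarrow> real) \<Rightarrow>
   ((real^'n) set \<Rightarrow> real^'n \<Rightarrow> real) \<Rightarrow> bool" where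
  "hybridized_wg_solution \<Omega> Th Eh k \<alpha> f g qh uh lam \<longleftrightarrow>
     (qh, uh) \<in> M_space Th Eh k \<and> lam \<in> Lambda_space Eh k \<and>
     (\<forall>e\<in>Eh. e \<subseteq> frontier \<Omega> \<longrightarrow> lam e = Qb k g e) \<and>
     (\<forall>T\<in>Th. flux_equation Eh k \<alpha> T lam (qh T) (uh T)) \<and>
     (\<forall>T\<in>Th. \<forall>w\<in>W_space k T. ip T (weak_div Eh k T (qh T)) w = ip T f w) \<and>
     (\<forall>\<phi>\<in>Lambda0_space \<Omega> Eh k. (\<Sum>T\<in>Th. bip Eh T (normal_trace T (qh T)) \<phi>) = 0)"

definition reduced_solution ::
  "(real^'n) set \<Rightarrow> (real^'n) set set \<Rightarrow> (real^'n) set set \<Rightarrow> nat \<Rightarrow> (real^'n \<Rightarrow> real^('n::finite)^'n) \<Rightarrow>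
   (real^'n \<Rightarrow> real) \<Rightarrow> (real^'n \<Rightarrow> real) \<Rightarrow> ((real^'n) set \<Rightarrow> real^'n \<Rightarrow> real) \<Rightarrow> bool" where
  "reduced_solution \<Omega> Th Eh k \<alpha> f g lam \<longleftrightarrow>
     lam \<in> Lambda_space Eh k \<and>
     (\<forall>e\<in>Eh. e \<subseteq> frontier \<Omega> \<longrightarrow> lam e = Qb k g e) \<and>
     (\<forall>\<phi>\<in>Lambda0_space \<Omega> Eh k.
        (\<Sum>T\<in>Th. stab Eh T (Hq Eh k \<alpha> lam T) (Hq Eh k \<alpha> \<phi> T) +
                 ipv T (\<lambda>x. \<alpha> x *v H0 Eh k \<alpha> lam T x) (H0 Eh k \<alpha> \<phi> T))
          = ip \<Omega> f (broken Th (Hu Eh k \<alpha> \<phi>)))"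

end

theory Submission
  imports Defs
begin

text \<open>
  Let \<open>(q, u)\<close> be the flux and potential of the hybridized scheme on an element \<open>T\<close>, \<open>\<lambda>\<close> its
  multiplier and \<open>\<phi>\<close> a multiplier that vanishes on the boundary of \<open>\<Omega>\<close>.  Write
  \<open>a(q, v) = s\<^sub>T(q, v) + (\<alpha> q\<^sub>0, v\<^sub>0)\<^sub>T\<close>, which is symmetric.  The fields \<open>H\<^sub>q(\<lambda>)\<close> and \<open>q\<close>
  satisfy flux equations with the same data \<open>\<lambda>\<close>.  Tested with \<open>H\<^sub>q(\<phi>)\<close>, whose weak divergence is
  orthogonal to all potentials, both reduce to
  \<open>a(H\<^sub>q(\<lambda>), H\<^sub>q(\<phi>)) = - \<langle>\<lambda>, H\<^sub>b(\<phi>) \<bullet> n\<rangle> = a(q, H\<^sub>q(\<phi>))\<close>.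
  The flux equation of \<open>H(\<phi>)\<close> tested with \<open>q\<close> turns the last expression into
  \<open>(f, H\<^sub>u(\<phi>))\<^sub>T - \<langle>\<phi>, q\<^sub>b \<bullet> n\<rangle>\<close> (lemma \<open>local_identity\<close>).  Summation over the elements removes
  the boundary terms by the continuity equation of the scheme.

  This computation needs the operator \<open>H\<close> and the weak divergence, both given by descriptions, to be
  well defined; that is the main part of the work.  Existence in both cases is the solvability of a square
  linear system (\<open>bilinear_system_solvable\<close>), so everything rests on definiteness.  For the weak
  divergence this is definiteness of the \<open>L\<^sup>2\<close> product on polynomials.  For the local problem
  (\<open>local_solution_exists\<close>, \<open>local_solution_unique\<close>) the energy \<open>a(v, v)\<close> vanishes only for \<open>v = 0\<close>
  (\<open>energy_definite\<close>), and a potential orthogonal to all weak divergences is zero (\<open>wdiv_kernel\<close>).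
  These facts use that an element is the closure of its connected interior and has a negligible boundary,
  that the unit outward normal is unique, and that a polynomial vanishing almost everywhere on an element
  or on a flat face is zero there.
\<close>

section \<open>Linear algebra: representing a functional\<close>

text \<open>Linear functionals on coefficient vectors, which are plain functions \<open>'k \<Rightarrow> real\<close> without a vector
  space structure of their own.\<close>

definition linear_functional :: "(('k \<Rightarrow> real) \<Rightarrow> real) \<Rightarrow> bool" where
  "linear_functional l \<longleftrightarrow> (\<forall>r c d. l (\<lambda>k. r * c k + d k) = r * l c + l d)"

lemma linear_functionalD:
  "linear_functional l \<Longrightarrow> l (\<lambda>k. r * c k + d k) = r * l c + l d"
  by (simp add: linear_functional_def)

lemma linear_functional_zero:
  assumes "linear_functional l" shows "l (\<lambda>k. 0) = 0"
  using linear_functionalD[OF assms, of 1 "\<lambda>k. 0" "\<lambda>k. 0"] by simp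

text \<open>
  By induction on the number of functionals: if the last one is nonzero at a point \<open>z\<close> of the common
  kernel of the others, subtracting a multiple of it makes \<open>b\<close> vanish at \<open>z\<close>.
\<close>

lemma functional_in_span_of_common_kernel:
  fixes l :: "'i \<Rightarrow> ('k \<Rightarrow> real) \<Rightarrow> real"
  assumes "finite I" "\<And>i. i \<in> I \<Longrightarrow> linear_functional (l i)" "linear_functional b"
    and "\<And>x. (\<And>i. i \<in> I \<Longrightarrow> l i x = 0) \<Longrightarrow> b x = 0"
  shows "\<exists>c. \<forall>x. b x = (\<Sum>i\<in>I. c i * l i x)"
  using assms
proof (induction I arbitrary: b rule: finite_induct)
  case empty
  then show ?case by simp
next
  case (insert j I)
  have lj: "linear_functional (l j)" using insert.prems by simp
  have li: "\<And>i. i \<in> I \<Longrightarrow> linear_functional (l i)" using insert.prems by simp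
  show ?case
  proof (cases "\<forall>x. (\<forall>i\<in>I. l i x = 0) \<longrightarrow> l j x = 0")
    case True
    then have "\<And>x. (\<And>i. i \<in> I \<Longrightarrow> l i x = 0) \<Longrightarrow> b x = 0"
      using insert.prems(3) by (metis insertE)
    from insert.IH[OF li insert.prems(2) this]
    obtain c where c: "\<forall>x. b x = (\<Sum>i\<in>I. c i * l i x)" by blast
    have "b x = (\<Sum>i\<in>insert j I. (c(j := 0)) i * l i x)" for x
      using c insert.hyps by (auto intro!: sum.cong)
    then show ?thesis by blast
  next
    case False
    then obtain z where z: "\<And>i. i \<in> I \<Longrightarrow> l i z = 0" "l j z \<noteq> 0" by blast
    define t where "t = b z / l j z"
    define b' where "b' x = b x - t * l j x" for x
    have lb': "linear_functional b'"
      using insert.prems(2) lj by (simp add: linear_functional_def b'_def algebra_simps)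
    have "b' x = 0" if x: "\<And>i. i \<in> I \<Longrightarrow> l i x = 0" for x
    proof -
      define y where "y = (\<lambda>k. (- (l j x / l j z)) * z k + x k)"
      have "l j y = 0"
        unfolding y_def linear_functionalD[OF lj] using z(2) by simp
      moreover have "l i y = 0" if "i \<in> I" for i
        unfolding y_def linear_functionalD[OF li[OF that]] using z(1)[OF that] x[OF that] by simp
      ultimately have "b y = 0" using insert.prems(3) by blast
      then have "b x = l j x / l j z * b z"
        unfolding y_def linear_functionalD[OF insert.prems(2)] by (simp add: algebra_simps)
      then show ?thesis by (simp add: b'_def t_def)
    qed
    from insert.IH[OF li lb' this]
    obtain c where c: "\<forall>x. b' x = (\<Sum>i\<in>I. c i * l i x)" by blast
    have "b x = (\<Sum>i\<in>insert j I. (c(j := t)) i * l i x)" for x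
    proof -
      have "(\<Sum>i\<in>I. (c(j := t)) i * l i x) = (\<Sum>i\<in>I. c i * l i x)"
        using insert.hyps by (intro sum.cong) auto
      then show ?thesis using c[rule_format, of x] insert.hyps by (simp add: b'_def)
    qed
    then show ?thesis by blast
  qed
qed

lemma linear_functional_expand:
  fixes l :: "('k \<Rightarrow> real) \<Rightarrow> real"
  assumes "finite K" "linear_functional l"
    and dep: "\<And>c d. (\<And>k. k \<in> K \<Longrightarrow> c k = d k) \<Longrightarrow> l c = l d"
  shows "l c = (\<Sum>k\<in>K. c k * l (\<lambda>j. if j = k then 1 else 0))"
proof -
  have "finite J \<Longrightarrow>
      l (\<lambda>j. if j \<in> J then c j else 0) = (\<Sum>k\<in>J. c k * l (\<lambda>j. if j = k then 1 else 0))" for J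
  proof (induction J rule: finite_induct)
    case empty
    then show ?case using linear_functional_zero[OF assms(2)] by simp
  next
    case (insert k J)
    have "(\<lambda>j. if j \<in> insert k J then c j else 0) =
        (\<lambda>j. c k * (if j = k then 1 else 0) + (if j \<in> J then c j else 0))"
      using insert.hyps by auto
    then show ?case using insert linear_functionalD[OF assms(2)] by simp
  qed
  from this[OF assms(1)] show ?thesis
    using dep[of c "\<lambda>j. if j \<in> K then c j else 0"] by simp
qed

text \<open>
  Solvability of a square linear system given by a bilinear form: it is enough that the right-hand
  side vanishes on the (right) kernel of the form.
\<close>

lemma bilinear_system_solvable:
  fixes B :: "('k \<Rightarrow> real) \<Rightarrow> ('k \<Rightarrow> real) \<Rightarrow> real"
  assumes K: "finite K"
    and B1: "\<And>d. linear_functional (\<lambda>c. B c d)"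
    and B2: "\<And>c. linear_functional (B c)"
    and L: "linear_functional L"
    and dep: "\<And>c c' d. (\<And>k. k \<in> K \<Longrightarrow> c k = c' k) \<Longrightarrow> B c d = B c' d"
    and ker: "\<And>d. (\<And>c. B c d = 0) \<Longrightarrow> L d = 0"
  shows "\<exists>c. \<forall>d. B c d = L d"
proof -
  let ?\<delta> = "\<lambda>k j. if j = k then 1 else (0::real)"
  have ex: "B c d = (\<Sum>k\<in>K. c k * B (?\<delta> k) d)" for c d
    by (rule linear_functional_expand[OF K B1]) (rule dep)
  have "\<exists>a. \<forall>d. L d = (\<Sum>k\<in>K. a k * B (?\<delta> k) d)"
  proof (rule functional_in_span_of_common_kernel[OF K B2 L])
    fix d assume "\<And>k. k \<in> K \<Longrightarrow> B (?\<delta> k) d = 0"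
    then have "B c d = 0" for c by (simp add: ex[of c d])
    then show "L d = 0" by (rule ker)
  qed
  then show ?thesis by (metis ex)
qed

section \<open>Polynomials on a set\<close>

text \<open>
  Exponents of total degree at most \<open>r\<close>, the polynomial with coefficients \<open>c\<close> on the whole space, and
  its restriction to \<open>D\<close> extended by zero.
\<close>

definition degs :: "nat \<Rightarrow> ('n::finite \<Rightarrow> nat) set" where
  "degs r = {m. (\<Sum>i\<in>UNIV. m i) \<le> r}"

definition poly_fun :: "nat \<Rightarrow> (('n::finite \<Rightarrow> nat) \<Rightarrow> real) \<Rightarrow> real^'n \<Rightarrow> real" where
  "poly_fun r c x = (\<Sum>m\<in>degs r. c m * (\<Prod>i\<in>UNIV. (x $ i) ^ m i))"

definition poly_on :: "nat \<Rightarrow> (real^'n) set \<Rightarrow> (('n::finite \<Rightarrow> nat) \<Rightarrow> real) \<Rightarrow> real^'n \<Rightarrow> real" where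
  "poly_on r D c x = (if x \<in> D then poly_fun r c x else 0)"

lemma finite_degs: "finite (degs r :: ('n::finite \<Rightarrow> nat) set)"
proof (rule finite_subset)
  show "(degs r :: ('n \<Rightarrow> nat) set) \<subseteq> PiE UNIV (\<lambda>_. {..r})"
  proof
    fix m :: "'n \<Rightarrow> nat" assume "m \<in> degs r"
    moreover have "m i \<le> (\<Sum>i\<in>UNIV. m i)" for i by (simp add: member_le_sum)
    ultimately show "m \<in> PiE UNIV (\<lambda>_. {..r})" unfolding degs_def by (auto intro: order_trans)
  qed
  show "finite (PiE (UNIV :: 'n set) (\<lambda>_. {..r}))" by (rule finite_PiE) auto
qed

lemma polys_eq_range: "polys r D = range (poly_on r D)"
  unfolding polys_def poly_on_def poly_fun_def degs_def fun_eq_iff image_def by auto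

lemma poly_on_linear:
  "poly_on r D (\<lambda>m. s * c m + d m) = (\<lambda>x. s * poly_on r D c x + poly_on r D d x)"
  by (auto simp: poly_on_def poly_fun_def fun_eq_iff algebra_simps sum.distrib sum_distrib_left)

lemma poly_on_cong:
  "(\<And>m. m \<in> degs r \<Longrightarrow> c m = d m) \<Longrightarrow> poly_on r D c = poly_on r D d"
  by (auto simp: poly_on_def poly_fun_def fun_eq_iff intro!: sum.cong)

lemma polys_linear:
  "p \<in> polys r D \<Longrightarrow> q \<in> polys r D \<Longrightarrow> (\<lambda>x. s * p x + q x) \<in> polys r D"
  unfolding polys_eq_range by (auto simp: poly_on_linear[symmetric])

lemma polys_zero: "(\<lambda>x. 0) \<in> polys r D"
  unfolding polys_eq_range
  by (rule image_eqI[where x = "\<lambda>m. 0"]) (auto simp: poly_on_def poly_fun_def)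

lemma polys_diff: "p \<in> polys r D \<Longrightarrow> q \<in> polys r D \<Longrightarrow> (\<lambda>x. p x - q x) \<in> polys r D"
  using polys_linear[of q r D p "-1"] by simp

lemma polys_scale: "p \<in> polys r D \<Longrightarrow> (\<lambda>x. s * p x) \<in> polys r D"
  using polys_linear[OF _ polys_zero, of p r D s] by simp

lemma polys_sum:
  assumes "\<And>i. i \<in> I \<Longrightarrow> p i \<in> polys r D"
  shows "(\<lambda>x. \<Sum>i\<in>I. s i * p i x) \<in> polys r D"
  using assms
proof (induction I rule: infinite_finite_induct)
  case (insert i I)
  have "(\<lambda>x. s i * p i x + (\<Sum>i\<in>I. s i * p i x)) \<in> polys r D"
    using insert by (intro polys_linear) auto
  then show ?case using insert by simp
qed (simp_all add: polys_zero)

lemma polys_monomial: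
  fixes m :: "'n::finite \<Rightarrow> nat"
  assumes "m \<in> degs r"
  shows "(\<lambda>x. if x \<in> D then \<Prod>i\<in>UNIV. (x $ i) ^ m i else 0) \<in> polys r D"
  unfolding polys_eq_range
proof (rule image_eqI)
  show "(\<lambda>x. if x \<in> D then \<Prod>i\<in>UNIV. (x $ i) ^ m i else 0) =
      poly_on r D (\<lambda>m'. if m' = m then 1 else 0)"
  proof (rule ext)
    fix x :: "real^'n"
    have "(\<Sum>m'\<in>degs r. (if m' = m then 1 else 0) * (\<Prod>i\<in>UNIV. (x $ i) ^ m' i)) =
        (\<Sum>m'\<in>degs r. if m = m' then \<Prod>i\<in>UNIV. (x $ i) ^ m' i else 0)"
      by (rule sum.cong) auto
    also have "\<dots> = (\<Prod>i\<in>UNIV. (x $ i) ^ m i)"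
      using assms by (subst sum.delta'[OF finite_degs]) simp
    finally show "(if x \<in> D then \<Prod>i\<in>UNIV. (x $ i) ^ m i else 0) =
        poly_on r D (\<lambda>m'. if m' = m then 1 else 0) x"
      by (simp add: poly_on_def poly_fun_def)
  qed
qed simp

lemma polys_const: "(\<lambda>x. if x \<in> D then a else 0) \<in> polys r D"
proof -
  have "(\<lambda>x. a * (if x \<in> D then \<Prod>i\<in>UNIV. (x $ i) ^ 0 else 0)) \<in> polys r D"
    by (intro polys_scale polys_monomial) (simp add: degs_def)
  then show ?thesis by (simp add: if_distrib cong: if_cong)
qed

lemma poly_fun_continuous: "continuous_on S (poly_fun r c)"
  unfolding poly_fun_def by (intro continuous_intros)

lemma polys_continuous_on:
  assumes "p \<in> polys r D" shows "continuous_on D p"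
proof -
  obtain c where "p = poly_on r D c" using assms by (auto simp: polys_eq_range)
  then show ?thesis
    using continuous_on_cong[of D D p "poly_fun r c"] poly_fun_continuous[of D r c]
    by (simp add: poly_on_def)
qed

lemma polys_borel:
  assumes "p \<in> polys r D" "closed D" shows "p \<in> borel_measurable borel"
proof -
  obtain c where "p = poly_on r D c" using assms by (auto simp: polys_eq_range)
  then have p: "p = (\<lambda>x. if x \<in> D then poly_fun r c x else 0)" by (auto simp: poly_on_def)
  have [measurable]: "poly_fun r c \<in> borel_measurable borel"
    by (intro borel_measurable_continuous_onI poly_fun_continuous)
  have [measurable]: "D \<in> sets borel" using assms by auto
  show ?thesis unfolding p by measurable
qed

lemma polys_bounded:
  assumes "p \<in> polys r D" "compact D" shows "\<exists>C. \<forall>x. \<bar>p x\<bar> \<le> C"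
proof -
  have "bounded (p ` D)"
    using assms polys_continuous_on compact_continuous_image compact_imp_bounded by blast
  then obtain C where C: "\<And>x. x \<in> D \<Longrightarrow> \<bar>p x\<bar> \<le> C" by (auto simp: bounded_iff)
  have "p x = 0" if "x \<notin> D" for x using assms(1) that by (auto simp: polys_eq_range poly_on_def)
  then have "\<bar>p x\<bar> \<le> max C 0" for x using C by (cases "x \<in> D") (force simp: le_max_iff_disj)+
  then show ?thesis by blast
qed

lemma polys_outside: "p \<in> polys r D \<Longrightarrow> x \<notin> D \<Longrightarrow> p x = 0"
  by (auto simp: polys_eq_range poly_on_def)

lemma polys_eq_zeroI:
  assumes "p \<in> polys r D" "\<And>x. x \<in> S \<Longrightarrow> p x = 0" "S \<subseteq> D" "D \<subseteq> closure S"
  shows "p = (\<lambda>x. 0)"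
proof
  fix x
  obtain c where p: "p = poly_on r D c" using assms by (auto simp: polys_eq_range)
  have "poly_fun r c y = 0" if "y \<in> closure S" for y
    using continuous_constant_on_closure[OF poly_fun_continuous[of "closure S" r c], of 0 y]
      assms(2,3) that by (auto simp: p poly_on_def subset_iff)
  then show "p x = 0" using assms(4) by (auto simp: p poly_on_def)
qed

lemma GDERIV_unique: "GDERIV f x :> D \<Longrightarrow> GDERIV f x :> E \<Longrightarrow> D = E"
proof -
  assume "GDERIV f x :> D" "GDERIV f x :> E"
  then have "(\<lambda>h. h \<bullet> D) = (\<lambda>h. h \<bullet> E)"
    unfolding gderiv_def by (rule has_derivative_unique)
  then have "(D - E) \<bullet> D = (D - E) \<bullet> E" by (rule fun_cong)
  then have "(D - E) \<bullet> (D - E) = 0" by (simp add: inner_diff_right)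
  then show "D = E" by simp
qed

lemma grad_eq: "GDERIV \<phi> x :> D \<Longrightarrow> grad \<phi> x = D"
  unfolding grad_def by (rule the_equality) (auto intro: GDERIV_unique)

lemma monomial_GDERIV:
  fixes m :: "'n::finite \<Rightarrow> nat"
  shows "GDERIV (\<lambda>x :: real^'n. \<Prod>i\<in>UNIV. (x $ i) ^ m i) x :>
    (\<chi> j. of_nat (m j) * (\<Prod>i\<in>UNIV. (x $ i) ^ (m(j := m j - 1)) i))"
proof -
  have 1: "((\<lambda>x :: real^'n. (x $ i) ^ m i) has_derivative
      (\<lambda>h. of_nat (m i) * (x $ i) ^ (m i - 1) * h $ i)) (at x)" for i
    by (rule has_derivative_eq_rhs, rule has_derivative_power,
        rule bounded_linear.has_derivative[OF bounded_linear_vec_nth has_derivative_ident])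
      (simp add: fun_eq_iff mult_ac)
  have 2: "(\<Prod>i\<in>UNIV. (x $ i) ^ (m(j := m j - 1)) i) =
      (x $ j) ^ (m j - 1) * (\<Prod>i\<in>UNIV - {j}. (x $ i) ^ m i)" for j
    by (subst prod.remove[of _ j]) (auto intro!: prod.cong)
  show ?thesis
    unfolding gderiv_def
    by (rule has_derivative_eq_rhs[OF has_derivative_prod[OF 1]])
      (simp add: fun_eq_iff inner_vec_def 2 mult_ac del: fun_upd_apply One_nat_def)
qed

lemma GDERIV_sum:
  assumes "\<And>i. i \<in> I \<Longrightarrow> GDERIV (f i) x :> D i"
  shows "GDERIV (\<lambda>x. \<Sum>i\<in>I. c i * f i x) x :> (\<Sum>i\<in>I. c i *\<^sub>R D i)"
proof -
  have "((\<lambda>x. \<Sum>i\<in>I. c i * f i x) has_derivative (\<lambda>h. \<Sum>i\<in>I. c i * (h \<bullet> D i))) (at x)"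
    using assms unfolding gderiv_def by (intro has_derivative_sum has_derivative_mult_right) auto
  then show ?thesis unfolding gderiv_def by (simp add: inner_sum_right)
qed

text \<open>On the interior of \<open>D\<close> the gradient of a polynomial on \<open>D\<close> is polynomial of one degree less.\<close>

lemma polys_gradient:
  fixes p :: "real^'n \<Rightarrow> real"
  assumes "p \<in> polys (k + 1) D"
  obtains G where "\<And>i. (\<lambda>x. G x $ i) \<in> polys k D"
    and "\<And>x. x \<in> interior D \<Longrightarrow> GDERIV p x :> G x"
proof -
  obtain c where p: "p = poly_on (k + 1) D c" using assms by (auto simp: polys_eq_range)
  define mon where "mon m x = (\<Prod>i\<in>UNIV. (x $ i) ^ m i)" for m :: "'n \<Rightarrow> nat" and x :: "real^'n"
  define dm where "dm m j = m(j := m j - 1)" for m :: "'n \<Rightarrow> nat" and j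
  \<comment> \<open>If \<open>m j = 0\<close>, the truncated exponent is harmless because the term carries the factor \<open>m j\<close>.\<close>
  define G :: "real^'n \<Rightarrow> real^'n" where
    "G x = (\<chi> j. \<Sum>m\<in>degs (k + 1). c m * (of_nat (m j) * (if x \<in> D then mon (dm m j) x else 0)))" for x
  have "(\<lambda>x. G x $ j) \<in> polys k D" for j
  proof -
    have "(\<lambda>x. of_nat (m j) * (if x \<in> D then mon (dm m j) x else 0)) \<in> polys k D"
      if m: "m \<in> degs (k + 1)" for m
    proof (cases "m j = 0")
      case True
      then show ?thesis by (simp add: polys_zero)
    next
      case False
      have "(\<Sum>i\<in>UNIV. m i) = m j + (\<Sum>i\<in>UNIV - {j}. m i)" by (simp add: sum.remove)
      moreover have "(\<Sum>i\<in>UNIV. dm m j i) = m j - 1 + (\<Sum>i\<in>UNIV - {j}. m i)"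
        by (subst sum.remove[of _ j]) (auto simp: dm_def intro!: sum.cong)
      ultimately have "dm m j \<in> degs k" using m False by (simp add: degs_def)
      then show ?thesis unfolding mon_def by (intro polys_scale polys_monomial)
    qed
    then show ?thesis unfolding G_def by (simp add: polys_sum)
  qed
  moreover have "GDERIV p x :> G x" if x: "x \<in> interior D" for x
  proof -
    have xD: "x \<in> D" using x interior_subset by blast
    have "GDERIV (poly_fun (k + 1) c) x :>
        (\<Sum>m\<in>degs (k + 1). c m *\<^sub>R (\<chi> j. of_nat (m j) * mon (dm m j) x))"
      unfolding poly_fun_def mon_def dm_def by (intro GDERIV_sum monomial_GDERIV)
    also have "(\<Sum>m\<in>degs (k + 1). c m *\<^sub>R (\<chi> j. of_nat (m j) * mon (dm m j) x)) = G x"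
      using xD by (simp add: G_def vec_eq_iff sum_component)
    finally have "(poly_fun (k + 1) c has_derivative (\<lambda>h. h \<bullet> G x)) (at x)"
      by (simp add: gderiv_def)
    then have "(p has_derivative (\<lambda>h. h \<bullet> G x)) (at x)"
      by (rule has_derivative_transform_within_open[OF _ open_interior x])
        (use interior_subset in \<open>auto simp: p poly_on_def\<close>)
    then show ?thesis by (simp add: gderiv_def)
  qed
  ultimately show thesis by (rule that)
qed

section \<open>Polytopal sets and their normals\<close>

lemma polytopal_compact: "polytopal m S \<Longrightarrow> compact S"
  unfolding polytopal_def using polytope_imp_compact by (metis compact_Union)

lemma polytopal_subset_closure_rel_interior:
  assumes "polytopal m S" shows "S \<subseteq> closure (rel_interior S)"
proof
  fix x assume "x \<in> S"
  obtain P where P: "\<And>p. p \<in> P \<Longrightarrow> polytope p" "\<And>p. p \<in> P \<Longrightarrow> aff_dim p = m" "S = \<Union>P"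
    using assms by (auto simp: polytopal_def)
  obtain p where p: "p \<in> P" "x \<in> p" using \<open>x \<in> S\<close> P(3) by blast
  have sub: "p \<subseteq> S" using p P(3) by blast
  have "affine hull p = affine hull S"
  proof (rule ccontr)
    assume "affine hull p \<noteq> affine hull S"
    then have "affine hull p \<subset> affine hull S" using hull_mono[OF sub] by blast
    then have "aff_dim p < aff_dim S" by (rule aff_dim_psubset)
    then show False using P(2)[OF p(1)] assms by (simp add: polytopal_def)
  qed
  then have "rel_interior p \<subseteq> rel_interior S" by (rule subset_rel_interior[OF sub])
  moreover have "x \<in> closure (rel_interior p)"
    using convex_closure_rel_interior[OF polytope_imp_convex[OF P(1)[OF p(1)]]] p(2) closure_subset
    by blast
  ultimately show "x \<in> closure (rel_interior S)" using closure_mono by blast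
qed

text \<open>A flat face has only two unit normals, and the outward one is the one that points out.\<close>

lemma is_outward_normal_unique:
  fixes e :: "(real^'n) set"
  assumes e: "polytopal (int CARD('n) - 1) e" "e \<noteq> {}"
    and n: "is_outward_normal T e n" and n': "is_outward_normal T e n'"
  shows "n' = n"
proof -
  obtain x where x: "x \<in> rel_interior e"
    using polytopal_subset_closure_rel_interior[OF e(1)] e(2) by fastforce
  then have xe: "x \<in> e" using rel_interior_subset by blast
  define A where "A = (\<lambda>y. - x + y) ` e"
  have "int (dim A) = int CARD('n) - 1"
    using aff_dim_eq_dim[OF hull_inc[OF xe]] e(1) unfolding A_def polytopal_def by simp
  then have dimA: "dim A + 1 = CARD('n)" by linarith
  define N where "N = {y \<in> (UNIV :: (real^'n) set). \<forall>x\<in>A. orthogonal x y}"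
  have "N = {y \<in> (UNIV :: (real^'n) set). \<forall>x\<in>span A. orthogonal x y}"
  proof -
    have "orthogonal z y" if "\<forall>x\<in>A. orthogonal x y" "z \<in> span A" for z y :: "real^'n"
      using orthogonal_to_span[OF that(2), of y] that(1) by (simp add: orthogonal_commute)
    then show ?thesis unfolding N_def using span_base by blast
  qed
  then have "dim N + dim (span A) = dim (UNIV :: (real^'n) set)"
    by (simp only:) (rule dim_subspace_orthogonal_to_vectors, auto)
  then have dimN: "dim N = 1" using dimA by simp
  have nN: "n \<in> N" "n' \<in> N"
  proof -
    have "\<nu> \<in> N" if "is_outward_normal T e \<nu>" for \<nu>
    proof -
      have "(y - x) \<bullet> \<nu> = 0" if "y \<in> e" for y
        using \<open>is_outward_normal T e \<nu>\<close> that xe by (simp add: is_outward_normal_def)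
      then show ?thesis by (simp add: N_def A_def orthogonal_def)
    qed
    then show "n \<in> N" "n' \<in> N" using n n' by auto
  qed
  have norms: "norm n = 1" "norm n' = 1" using n n' by (auto simp: is_outward_normal_def)
  have "N \<subseteq> span {n}"
  proof (rule card_ge_dim_independent)
    show "independent {n}" using norms by auto
  qed (use nN dimN in auto)
  then obtain t where t: "n' = t *\<^sub>R n" using nN(2) by (auto simp: span_singleton)
  then have "\<bar>t\<bar> = 1" using norms by simp
  then consider "t = 1" | "t = -1" by linarith
  then show ?thesis
  proof cases
    case 2
    obtain \<epsilon> \<epsilon>' where "\<epsilon> > 0" "\<epsilon>' > 0"
      and 1: "\<And>s. 0 < s \<Longrightarrow> s < \<epsilon> \<Longrightarrow> x + s *\<^sub>R n \<notin> T"
      and 2: "\<And>s. 0 < s \<Longrightarrow> s < \<epsilon>' \<Longrightarrow> x - s *\<^sub>R n' \<in> interior T"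
      using n n' x unfolding is_outward_normal_def by metis
    \<comment> \<open>If \<open>n' = - n\<close>, a short step from \<open>x\<close> along \<open>n\<close> leads both out of \<open>T\<close> and into it.\<close>
    define s where "s = min \<epsilon> \<epsilon>' / 2"
    have "0 < s" "s < \<epsilon>" "s < \<epsilon>'" using \<open>\<epsilon> > 0\<close> \<open>\<epsilon>' > 0\<close> by (auto simp: s_def)
    then show ?thesis using 1[of s] 2[of s] t \<open>t = -1\<close> interior_subset[of T] by auto
  qed (use t in simp)
qed

lemma outward_normal_eq:
  fixes e :: "(real^'n) set"
  assumes "polytopal (int CARD('n) - 1) e" "e \<noteq> {}" "is_outward_normal T e n"
  shows "outward_normal T e = n"
  unfolding outward_normal_def
  by (rule the_equality, rule assms(3)) (rule is_outward_normal_unique[OF assms(1,2,3)])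

lemma negligible_of_normal:
  fixes e :: "(real^'n) set"
  assumes "norm n = 1" "\<And>x y. x \<in> e \<Longrightarrow> y \<in> e \<Longrightarrow> (x - y) \<bullet> n = 0"
  shows "negligible e"
proof (cases "e = {}")
  case False
  then obtain y where y: "y \<in> e" by blast
  have "n \<noteq> 0" using assms(1) by auto
  then have "negligible {x. n \<bullet> x = n \<bullet> y}" by (intro negligible_hyperplane) auto
  moreover have "e \<subseteq> {x. n \<bullet> x = n \<bullet> y}"
  proof
    fix x assume "x \<in> e"
    then have "(x - y) \<bullet> n = 0" by (rule assms(2)[OF _ y])
    then show "x \<in> {x. n \<bullet> x = n \<bullet> y}" by (simp add: inner_diff_left inner_commute[of n])
  qed
  ultimately show ?thesis by (rule negligible_subset)
qed simp

section \<open>Integration of bounded functions\<close>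

text \<open>
  Bounded Borel functions, which are integrable for every finite Borel measure and its completion.
  A polynomial on a compact set, extended by zero, is of this kind.
\<close>

definition bdd_borel :: "(real^'n \<Rightarrow> real) \<Rightarrow> bool" where
  "bdd_borel f \<longleftrightarrow> f \<in> borel_measurable borel \<and> (\<exists>C. \<forall>x. \<bar>f x\<bar> \<le> C)"

lemma bdd_borel_const [intro]: "bdd_borel (\<lambda>x. a)"
  by (auto simp: bdd_borel_def)

lemma bdd_borel_mult [intro]:
  assumes "bdd_borel f" "bdd_borel g" shows "bdd_borel (\<lambda>x. f x * g x)"
proof -
  obtain C D where C: "\<And>x. \<bar>f x\<bar> \<le> C" and D: "\<And>x. \<bar>g x\<bar> \<le> D"
    using assms by (auto simp: bdd_borel_def)
  have "\<bar>f x * g x\<bar> \<le> C * D" for x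
    unfolding abs_mult using C[of x] D[of x] by (intro mult_mono) auto
  then show ?thesis using assms by (auto simp: bdd_borel_def)
qed

lemma bdd_borel_add [intro]:
  assumes "bdd_borel f" "bdd_borel g" shows "bdd_borel (\<lambda>x. f x + g x)"
proof -
  obtain C D where C: "\<And>x. \<bar>f x\<bar> \<le> C" and D: "\<And>x. \<bar>g x\<bar> \<le> D"
    using assms by (auto simp: bdd_borel_def)
  have "\<bar>f x + g x\<bar> \<le> C + D" for x
    using C[of x] D[of x] by linarith
  then show ?thesis using assms by (auto simp: bdd_borel_def)
qed

lemma bdd_borel_minus [intro]:
  assumes "bdd_borel f" "bdd_borel g" shows "bdd_borel (\<lambda>x. f x - g x)"
  using bdd_borel_add[OF assms(1) bdd_borel_mult[OF bdd_borel_const[of "-1"] assms(2)]] by simp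

lemma bdd_borel_sum [intro]:
  "(\<And>i. i \<in> I \<Longrightarrow> bdd_borel (f i)) \<Longrightarrow> bdd_borel (\<lambda>x. \<Sum>i\<in>I. f i x)"
  by (induction I rule: infinite_finite_induct) auto

lemma bdd_borel_inner:
  fixes f g :: "real^'n \<Rightarrow> real^'m"
  assumes "\<And>i. bdd_borel (\<lambda>x. f x $ i)" "\<And>i. bdd_borel (\<lambda>x. g x $ i)"
  shows "bdd_borel (\<lambda>x. f x \<bullet> g x)"
  unfolding inner_vec_def inner_real_def by (intro bdd_borel_sum bdd_borel_mult assms)

lemma polys_bdd_borel: "p \<in> polys r D \<Longrightarrow> compact D \<Longrightarrow> bdd_borel p"
  by (simp add: bdd_borel_def polys_borel polys_bounded compact_imp_closed)

lemma bdd_borel_integrable: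
  assumes "bdd_borel h" "finite_measure M" "h \<in> borel_measurable M"
  shows "integrable M h"
proof -
  obtain C where "\<And>x. \<bar>h x\<bar> \<le> C" using assms(1) by (auto simp: bdd_borel_def)
  then show ?thesis
    by (intro finite_measure.integrable_const_bound[OF assms(2) _ assms(3), of C]) auto
qed

lemma bdd_borel_integrable_lebesgue_on:
  assumes "bdd_borel h" "U \<in> lmeasurable"
  shows "integrable (lebesgue_on U) h"
  using assms
  by (intro bdd_borel_integrable finite_measure_lebesgue_on measurable_restrict_space1
      measurable_completion) (auto simp: bdd_borel_def)

lemma integral_lebesgue_cong_AE:
  fixes f g :: "real^'n \<Rightarrow> real"
  assumes "AE x in lebesgue. f x = g x"
  shows "integral\<^sup>L lebesgue f = integral\<^sup>L lebesgue g"
proof (cases "f \<in> borel_measurable lebesgue")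
  case True
  then have "g \<in> borel_measurable lebesgue" using borel_measurable_AE assms by blast
  with True show ?thesis using assms by (intro integral_cong_AE)
next
  case False
  have "AE x in lebesgue. g x = f x" using assms by auto
  then have "g \<notin> borel_measurable lebesgue" using False borel_measurable_AE by blast
  then show ?thesis using False
    by (metis borel_measurable_integrable not_integrable_integral_eq)
qed

text \<open>Integrals over \<open>T\<close> do not see a negligible boundary.\<close>

lemma set_integral_interior:
  fixes h :: "real^'n \<Rightarrow> real"
  assumes "negligible (frontier T)"
  shows "(LINT x:T|lebesgue. h x) = integral\<^sup>L (lebesgue_on (interior T)) h"
proof -
  have "AE x in lebesgue. x \<notin> frontier T"
    using assms by (auto simp: eventually_ae_filter_negligible)
  then have "AE x in lebesgue. indicator T x *\<^sub>R h x = indicator (interior T) x *\<^sub>R h x"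
  proof (rule AE_mp, intro AE_I2 impI)
    fix x assume "x \<notin> frontier T"
    then have "x \<in> T \<longleftrightarrow> x \<in> interior T"
      using closure_subset interior_subset by (auto simp: frontier_def)
    then show "indicator T x *\<^sub>R h x = indicator (interior T) x *\<^sub>R h x" by (simp add: indicator_def)
  qed
  then show ?thesis
    by (simp add: set_lebesgue_integral_def integral_lebesgue_cong_AE integral_restrict_space)
qed

section \<open>The surface measure of a flat face\<close>

text \<open>The slab on which Lebesgue measure is pushed forward to the surface measure.\<close>

lemma slab_compact:
  fixes e :: "(real^'n) set"
  assumes "compact e" "e \<noteq> {}"
  shows "compact {y. closest_point (affine hull e) y \<in> e \<and>
                     dist y (closest_point (affine hull e) y) \<le> 1/2}" (is "compact ?S")
proof -
  let ?c = "closest_point (affine hull e)"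
  have cont: "continuous_on UNIV ?c"
    by (intro continuous_on_closest_point) (use assms in \<open>auto simp: affine_imp_convex\<close>)
  have "closed (?c -` e)"
    using cont assms(1) by (simp add: closed_vimage compact_imp_closed)
  moreover have "closed {y. dist y (?c y) \<le> 1/2}"
    using cont by (intro closed_Collect_le continuous_intros) auto
  ultimately have "closed (?c -` e \<inter> {y. dist y (?c y) \<le> 1/2})" by (rule closed_Int)
  moreover have "?c -` e \<inter> {y. dist y (?c y) \<le> 1/2} = ?S" by auto
  moreover have "bounded ?S"
  proof -
    obtain C where C: "\<And>x. x \<in> e \<Longrightarrow> norm x \<le> C"
      using compact_imp_bounded[OF assms(1)] by (auto simp: bounded_iff)
    have "norm y \<le> C + 1/2" if "y \<in> ?S" for y
      using that C[of "?c y"] norm_triangle_sub[of y "?c y"] by (auto simp: dist_norm)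
    then show ?thesis by (auto simp: bounded_iff)
  qed
  ultimately show ?thesis by (simp add: compact_eq_bounded_closed)
qed

lemma closest_point_affine_hull_borel:
  fixes e :: "(real^'n) set"
  assumes "e \<noteq> {}"
  shows "closest_point (affine hull e) \<in> borel_measurable borel"
  by (intro borel_measurable_continuous_onI continuous_on_closest_point)
    (use assms in \<open>auto simp: affine_imp_convex\<close>)

lemma closest_point_affine_hull_measurable:
  fixes e :: "(real^'n) set"
  assumes "e \<noteq> {}"
  shows "closest_point (affine hull e) \<in> borel_measurable (lebesgue_on S)"
  using closest_point_affine_hull_borel[OF assms]
  by (intro measurable_restrict_space1 measurable_completion) auto

lemma finite_measure_face_measure:
  fixes e :: "(real^'n) set"
  assumes "compact e" "e \<noteq> {}"
  shows "finite_measure (face_measure e)"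
proof -
  let ?c = "closest_point (affine hull e)"
  let ?L = "lebesgue_on {y. ?c y \<in> e \<and> dist y (?c y) \<le> 1/2}"
  have "finite_measure ?L"
    by (intro finite_measure_lebesgue_on lmeasurable_compact slab_compact assms)
  then interpret D: finite_measure "distr ?L borel ?c"
    by (intro finite_measure.finite_measure_distr closest_point_affine_hull_measurable assms)
  show ?thesis
    unfolding face_measure_def
    by (rule finite_measureI) (use D.emeasure_finite in \<open>simp add: space_completion\<close>)
qed

lemma borel_measurable_face_measure:
  "h \<in> borel_measurable borel \<Longrightarrow> h \<in> borel_measurable (face_measure e)"
  unfolding face_measure_def by (intro measurable_completion) simp

lemma bdd_borel_integrable_face:
  fixes e :: "(real^'n) set"
  assumes "bdd_borel h" "compact e" "e \<noteq> {}"
  shows "integrable (face_measure e) h"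
  using assms by (intro bdd_borel_integrable finite_measure_face_measure borel_measurable_face_measure)
    (auto simp: bdd_borel_def)

lemma AE_face_measure_iff:
  fixes e :: "(real^'n) set"
  assumes "e \<noteq> {}" "{x. P x} \<in> sets borel"
  shows "(AE x in face_measure e. P x) \<longleftrightarrow>
    (AE y in lebesgue_on {y. closest_point (affine hull e) y \<in> e \<and>
        dist y (closest_point (affine hull e) y) \<le> 1/2}. P (closest_point (affine hull e) y))"
  unfolding face_measure_def AE_completion_iff
  by (rule AE_distr_iff) (use assms closest_point_affine_hull_measurable in auto)

text \<open>
  A polynomial that vanishes almost everywhere on a face vanishes on it: the slab over the face
  contains a full-dimensional neighbourhood of each relative interior point.
\<close>

lemma polys_face_AE_zero:
  fixes e :: "(real^'n) set"
  assumes p: "p \<in> polys r e" and e: "compact e" "e \<noteq> {}" "e \<subseteq> closure (rel_interior e)"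
    and AE: "AE x in face_measure e. p x = 0"
  shows "p = (\<lambda>x. 0)"
proof (rule polys_eq_zeroI[OF p _ rel_interior_subset e(3)])
  fix x assume x: "x \<in> rel_interior e"
  let ?c = "closest_point (affine hull e)"
  let ?S = "{y. ?c y \<in> e \<and> dist y (?c y) \<le> 1/2}"
  have xe: "x \<in> e" using x rel_interior_subset by blast
  obtain \<epsilon> where \<epsilon>: "\<epsilon> > 0" "ball x \<epsilon> \<inter> affine hull e \<subseteq> e"
    using x by (auto simp: mem_rel_interior_ball)
  obtain c where c: "p = poly_on r e c" using p by (auto simp: polys_eq_range)
  have hull: "convex (affine hull e)" "closed (affine hull e)" "affine hull e \<noteq> {}"
    using e(2) by (auto simp: affine_imp_convex)
  have cx: "?c x = x" by (rule closest_point_self) (rule hull_inc[OF xe])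
  have ball_S: "ball x (min \<epsilon> (1/4)) \<subseteq> ?S"
  proof
    fix y assume y: "y \<in> ball x (min \<epsilon> (1/4))"
    have d: "dist x (?c y) \<le> dist x y"
      using closest_point_lipschitz[OF hull, of x y] cx by simp
    moreover have "?c y \<in> affine hull e" by (rule closest_point_in_set[OF hull(2,3)])
    ultimately have "?c y \<in> e" using y \<epsilon>(2) by auto
    moreover have "dist y (?c y) \<le> dist x y + dist x (?c y)"
      by (metis dist_commute dist_triangle)
    ultimately show "y \<in> ?S" using d y by auto
  qed
  have "AE y in lebesgue_on ?S. p (?c y) = 0"
  proof (subst AE_face_measure_iff[symmetric])
    have "p \<in> borel_measurable borel" using p e(1) compact_imp_closed polys_borel by blast
    then show "{x. p x = 0} \<in> sets borel" by measurable
  qed (use AE e in auto)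
  moreover have "?S \<in> sets lebesgue"
    using slab_compact[OF e(1,2)] by (intro lmeasurable_compact fmeasurableD)
  ultimately have "AE y\<in>?S in lebesgue. p (?c y) = 0"
    by (simp add: AE_restrict_space_iff)
  then have AE': "AE y\<in>ball x (min \<epsilon> (1/4)) in lebesgue. y \<in> {y. poly_fun r c (?c y) = 0}"
  proof (rule AE_mp, intro AE_I2 impI)
    fix y assume *: "y \<in> ?S \<longrightarrow> p (?c y) = 0" "y \<in> ball x (min \<epsilon> (1/4))"
    then have "y \<in> ?S" using ball_S by blast
    then show "y \<in> {y. poly_fun r c (?c y) = 0}" using *(1) by (simp add: c poly_on_def)
  qed
  have "continuous_on UNIV (\<lambda>y. poly_fun r c (?c y))"
    using poly_fun_continuous[of UNIV r c]
    by (rule continuous_on_compose2[OF _ continuous_on_closest_point]) (use hull in auto)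
  then have "closed {y. poly_fun r c (?c y) = 0}"
    by (intro closed_Collect_eq continuous_intros)
  from mem_closed_if_AE_lebesgue_open[OF open_ball this AE', of x]
  show "p x = 0" using \<epsilon>(1) cx xe by (simp add: c poly_on_def)
qed

lemma polys_AE_zero:
  fixes T :: "(real^'n) set"
  assumes p: "p \<in> polys r T" and T: "T \<subseteq> closure (interior T)"
    and AE: "AE x in lebesgue_on (interior T). p x = 0"
  shows "p = (\<lambda>x. 0)"
proof (rule polys_eq_zeroI[OF p _ interior_subset T])
  fix x assume x: "x \<in> interior T"
  obtain c where c: "p = poly_on r T c" using p by (auto simp: polys_eq_range)
  have "AE x\<in>interior T in lebesgue. p x = 0" using AE by (simp add: AE_restrict_space_iff)
  then have "AE x\<in>interior T in lebesgue. x \<in> {x. poly_fun r c x = 0}"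
    by (rule AE_mp) (use interior_subset[of T] in \<open>auto intro!: AE_I2 simp: c poly_on_def\<close>)
  moreover have "closed {x. poly_fun r c x = 0}"
    using poly_fun_continuous[of UNIV r c] by (intro closed_Collect_eq continuous_intros)
  ultimately show "p x = 0"
    using mem_closed_if_AE_lebesgue_open[OF open_interior, of "{x. poly_fun r c x = 0}" T x] x
    by (simp add: c poly_on_def)
qed

section \<open>The forms of the local problem\<close>

text \<open>
  One element \<open>T\<close> with its faces and the coefficient on it: exactly the properties of the mesh and of
  \<open>\<alpha>\<close> that make the local problem well posed.
\<close>

locale mesh_element =
  fixes Eh :: "(real^'n) set set" and T :: "(real^'n) set" and k :: nat
    and \<alpha> :: "real^'n \<Rightarrow> real^'n^'n"
  assumes finite_faces: "finite (faces Eh T)"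
    and faces_nonempty: "faces Eh T \<noteq> {}"
    and face_compact: "e \<in> faces Eh T \<Longrightarrow> compact e"
    and face_nonempty: "e \<in> faces Eh T \<Longrightarrow> e \<noteq> {}"
    and face_closure: "e \<in> faces Eh T \<Longrightarrow> e \<subseteq> closure (rel_interior e)"
    and normal_unit: "e \<in> faces Eh T \<Longrightarrow> norm (outward_normal T e) = 1"
    and T_compact: "compact T"
    and T_closure: "T \<subseteq> closure (interior T)"
    and T_connected: "connected (interior T)"
    and T_interior: "interior T \<noteq> {}"
    and T_frontier: "negligible (frontier T)"
    and coeff_measurable: "\<alpha> \<in> borel_measurable (lebesgue_on (interior T))"
    and coeff_bounded: "\<exists>C. AE x in lebesgue_on (interior T). norm (\<alpha> x) \<le> C"
    and coeff_symmetric: "AE x in lebesgue_on (interior T). transpose (\<alpha> x) = \<alpha> x"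
    and coeff_coercive:
      "\<exists>c>0. AE x in lebesgue_on (interior T). \<forall>\<xi>. c * (norm \<xi>)\<^sup>2 \<le> \<xi> \<bullet> (\<alpha> x *v \<xi>)"
begin

abbreviation "M \<equiv> lebesgue_on (interior T)"
abbreviation "V \<equiv> V_space Eh k T"
abbreviation "W \<equiv> polys (k + 1) T"

lemma face_subset: "e \<in> faces Eh T \<Longrightarrow> e \<subseteq> T"
  using frontier_subset_compact[OF T_compact] by (auto simp: faces_def)

lemma interior_lmeasurable: "interior T \<in> lmeasurable"
  by (meson T_compact bounded_interior compact_imp_bounded lmeasurable_interior)

lemma space_M: "space M = interior T"
  by (simp add: space_restrict_space)

lemmas M_integrable = bdd_borel_integrable_lebesgue_on[OF _ interior_lmeasurable]

lemma ip_eq: "ip T f g = (LINT x|M. f x * g x)"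
  unfolding ip_def by (rule set_integral_interior[OF T_frontier])

lemma ipv_eq: "ipv T f g = (LINT x|M. f x \<bullet> g x)"
  unfolding ipv_def by (rule set_integral_interior[OF T_frontier])

lemma diameter_pos: "0 < diameter T"
proof -
  obtain x \<epsilon> where x: "\<epsilon> > 0" "cball x \<epsilon> \<subseteq> T"
    using T_interior mem_interior_cball by (metis ex_in_conv)
  obtain i :: 'n where True by simp
  let ?y = "x + \<epsilon> *\<^sub>R axis i 1"
  have "?y \<in> T" "x \<in> T" using x by (auto simp: dist_norm subset_iff)
  then have "dist x ?y \<le> diameter T"
    using T_compact compact_imp_bounded diameter_bounded_bound by blast
  then show ?thesis using x(1) by (simp add: dist_norm)
qed

lemma polys_T_bdd: "\<phi> \<in> polys r T \<Longrightarrow> bdd_borel \<phi>"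
  using polys_bdd_borel T_compact by blast

lemmas W_bdd = polys_T_bdd[where r = "k + 1"]

lemma V_interior: "v \<in> V \<Longrightarrow> (\<lambda>x. fst v x $ i) \<in> polys k T"
  by (auto simp: V_space_def)

lemma V_face:
  assumes "v \<in> V" "e \<in> faces Eh T"
  obtains w where "w \<in> polys k e" "snd v e = (\<lambda>x. w x *\<^sub>R outward_normal T e)"
    "normal_trace T v e = w"
proof -
  obtain w where w: "w \<in> polys k e" "snd v e = (\<lambda>x. w x *\<^sub>R outward_normal T e)"
    using assms by (force simp: V_space_def)
  have "normal_trace T v e = w"
    using normal_unit[OF assms(2)] by (simp add: fun_eq_iff normal_trace_def w(2) norm_eq_1)
  with w show thesis by (rule that)
qed

lemma normal_trace_polys: "v \<in> V \<Longrightarrow> e \<in> faces Eh T \<Longrightarrow> normal_trace T v e \<in> polys k e"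
  by (elim V_face) auto

lemma normal_trace_bdd: "v \<in> V \<Longrightarrow> e \<in> faces Eh T \<Longrightarrow> bdd_borel (normal_trace T v e)"
  using normal_trace_polys polys_bdd_borel face_compact by blast

text \<open>The normal component of \<open>v\<^sub>0 - v\<^sub>b\<close> on a face, which the stabilizer penalizes.\<close>

definition jump :: "'n weak_field \<Rightarrow> (real^'n) set \<Rightarrow> real^'n \<Rightarrow> real" where
  "jump v e x = (fst v x - snd v e x) \<bullet> outward_normal T e"

lemma jump_eq: "jump v e x = fst v x \<bullet> outward_normal T e - normal_trace T v e x"
  by (simp add: jump_def normal_trace_def inner_diff_left)

lemma jump_bdd:
  assumes "v \<in> V" "e \<in> faces Eh T" shows "bdd_borel (jump v e)"
  unfolding jump_eq[abs_def]
  by (intro bdd_borel_minus bdd_borel_inner bdd_borel_const normal_trace_bdd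
      polys_T_bdd[OF V_interior] assms)

lemma stab_eq: "stab Eh T q v = diameter T * bip Eh T (jump q) (jump v)"
  by (simp add: stab_def jump_def[abs_def])

text \<open>Families of bounded Borel functions indexed by the faces; on these \<open>bip\<close> is bilinear.\<close>

definition bdd_faces :: "((real^'n) set \<Rightarrow> real^'n \<Rightarrow> real) \<Rightarrow> bool" where
  "bdd_faces a \<longleftrightarrow> (\<forall>e\<in>faces Eh T. bdd_borel (a e))"

lemma bip_linear:
  assumes "bdd_faces a" "bdd_faces a'" "bdd_faces b"
  shows "bip Eh T (\<lambda>e x. r * a e x + a' e x) b = r * bip Eh T a b + bip Eh T a' b"
proof -
  have "(LINT x|face_measure e. (r * a e x + a' e x) * b e x) =
      r * (LINT x|face_measure e. a e x * b e x) + (LINT x|face_measure e. a' e x * b e x)"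
    if e: "e \<in> faces Eh T" for e
  proof -
    have "integrable (face_measure e) (\<lambda>x. a e x * b e x)"
      "integrable (face_measure e) (\<lambda>x. a' e x * b e x)"
      using assms e
      by (auto simp: bdd_faces_def intro!: bdd_borel_integrable_face face_compact face_nonempty)
    then show ?thesis by (simp add: distrib_right mult.assoc)
  qed
  then show ?thesis by (simp add: bip_def sum.distrib sum_distrib_left)
qed

lemma bip_commute: "bip Eh T a b = bip Eh T b a"
  by (simp add: bip_def mult.commute)

lemma bip_nonneg: "0 \<le> bip Eh T a a"
  unfolding bip_def by (intro sum_nonneg integral_nonneg_AE) auto

lemma bip_eq_0D:
  assumes "bdd_faces a" "bip Eh T a a = 0" "e \<in> faces Eh T"
  shows "AE x in face_measure e. a e x = 0"
proof -
  have "bdd_borel (\<lambda>x. a e x * a e x)" using assms by (auto simp: bdd_faces_def)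
  then have int: "integrable (face_measure e) (\<lambda>x. a e x * a e x)"
    using bdd_borel_integrable_face face_compact face_nonempty assms(3) by blast
  have "(LINT x|face_measure e. a e x * a e x) = 0"
    using assms(2,3) unfolding bip_def
    by (subst (asm) sum_nonneg_eq_0_iff[OF finite_faces]) (auto intro: integral_nonneg_AE)
  then show ?thesis by (subst (asm) integral_nonneg_eq_0_iff_AE[OF int]) auto
qed

lemma bdd_faces_normal_trace: "v \<in> V \<Longrightarrow> bdd_faces (normal_trace T v)"
  by (simp add: bdd_faces_def normal_trace_bdd)

lemma bdd_faces_jump: "v \<in> V \<Longrightarrow> bdd_faces (jump v)"
  by (simp add: bdd_faces_def jump_bdd)

lemma bdd_faces_W: "\<phi> \<in> W \<Longrightarrow> bdd_faces (\<lambda>e. \<phi>)"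
  by (simp add: bdd_faces_def W_bdd)

text \<open>The weak field \<open>r v + v'\<close>; weak fields are pairs of functions and carry no vector space structure
  of their own.\<close>

definition lin_field :: "real \<Rightarrow> 'n weak_field \<Rightarrow> 'n weak_field \<Rightarrow> 'n weak_field" where
  "lin_field r v v' = ((\<lambda>x. r *\<^sub>R fst v x + fst v' x), (\<lambda>e x. r *\<^sub>R snd v e x + snd v' e x))"

lemma normal_trace_lin:
  "normal_trace T (lin_field r v v') = (\<lambda>e x. r * normal_trace T v e x + normal_trace T v' e x)"
  by (simp add: fun_eq_iff normal_trace_def lin_field_def inner_add_left)

lemma jump_lin: "jump (lin_field r v v') = (\<lambda>e x. r * jump v e x + jump v' e x)"
  by (simp add: fun_eq_iff jump_def lin_field_def inner_add_left inner_diff_left algebra_simps)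

lemma stab_commute: "stab Eh T q v = stab Eh T v q"
  by (simp add: stab_eq bip_commute)

lemma stab_linear:
  assumes "q \<in> V" "q' \<in> V" "v \<in> V"
  shows "stab Eh T (lin_field r q q') v = r * stab Eh T q v + stab Eh T q' v"
  unfolding stab_eq jump_lin
  by (subst bip_linear) (use assms in \<open>auto simp: bdd_faces_jump algebra_simps\<close>)

text \<open>The inner product of the interior parts weighted by \<open>\<alpha>\<close>.\<close>

definition wip :: "'n weak_field \<Rightarrow> 'n weak_field \<Rightarrow> real" where
  "wip q v = ipv T (\<lambda>x. \<alpha> x *v fst q x) (fst v)"

lemma coeff_entry_measurable: "(\<lambda>x. \<alpha> x $ i $ j) \<in> borel_measurable M"
proof -
  have "(\<lambda>A :: real^'n^'n. A $ i $ j) \<in> borel_measurable borel"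
    by (intro borel_measurable_continuous_onI continuous_intros)
  from measurable_compose[OF coeff_measurable this] show ?thesis .
qed

lemma coeff_integrable:
  assumes "bdd_borel h" shows "integrable M (\<lambda>x. \<alpha> x $ i $ j * h x)"
proof -
  obtain C where C: "AE x in M. norm (\<alpha> x) \<le> C" using coeff_bounded by blast
  obtain D where D: "\<And>x. \<bar>h x\<bar> \<le> D" using assms by (auto simp: bdd_borel_def)
  have "h \<in> borel_measurable M"
    using borel_measurable_integrable M_integrable assms by blast
  moreover have "AE x in M. norm (\<alpha> x $ i $ j * h x) \<le> C * D"
  proof (rule AE_mp[OF C], intro AE_I2 impI)
    fix x assume "norm (\<alpha> x) \<le> C"
    moreover have "\<bar>\<alpha> x $ i $ j\<bar> \<le> norm (\<alpha> x)"
      using component_le_norm_cart[of "\<alpha> x $ i" j] Finite_Cartesian_Product.norm_nth_le[of "\<alpha> x" i] by linarith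
    ultimately have "\<bar>\<alpha> x $ i $ j\<bar> \<le> C" by linarith
    then show "norm (\<alpha> x $ i $ j * h x) \<le> C * D"
      unfolding real_norm_def abs_mult using D[of x] by (intro mult_mono) auto
  qed
  ultimately show ?thesis
    using coeff_entry_measurable
    by (intro finite_measure.integrable_const_bound finite_measure_lebesgue_on interior_lmeasurable)
      auto
qed

lemma wip_integrable:
  assumes "q \<in> V" "v \<in> V"
  shows "integrable M (\<lambda>x. (\<alpha> x *v fst q x) \<bullet> fst v x)"
proof -
  have "(\<lambda>x. (\<alpha> x *v fst q x) \<bullet> fst v x) =
      (\<lambda>x. \<Sum>i\<in>UNIV. \<Sum>j\<in>UNIV. \<alpha> x $ i $ j * (fst q x $ j * fst v x $ i))"
    by (simp add: fun_eq_iff inner_vec_def matrix_vector_mult_def sum_distrib_right mult.assoc)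
  moreover have "integrable M (\<lambda>x. \<alpha> x $ i $ j * (fst q x $ j * fst v x $ i))" for i j
    by (intro coeff_integrable bdd_borel_mult polys_T_bdd[OF V_interior] assms)
  ultimately show ?thesis by simp
qed

lemma wip_linear:
  assumes "q \<in> V" "q' \<in> V" "v \<in> V"
  shows "wip (lin_field r q q') v = r * wip q v + wip q' v"
proof -
  have "(\<alpha> x *v fst (lin_field r q q') x) \<bullet> fst v x =
      r * ((\<alpha> x *v fst q x) \<bullet> fst v x) + (\<alpha> x *v fst q' x) \<bullet> fst v x" for x
    by (simp add: lin_field_def matrix_vector_right_distrib matrix_vector_mult_scaleR inner_add_left)
  then show ?thesis
    using wip_integrable[OF assms(1,3)] wip_integrable[OF assms(2,3)] by (simp add: wip_def ipv_eq)
qed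

lemma wip_commute:
  assumes "q \<in> V" "v \<in> V" shows "wip q v = wip v q"
  unfolding wip_def ipv_eq
proof (rule integral_cong_AE)
  show "AE x in M. (\<alpha> x *v fst q x) \<bullet> fst v x = (\<alpha> x *v fst v x) \<bullet> fst q x"
  proof (rule AE_mp[OF coeff_symmetric], intro AE_I2 impI)
    fix x assume "transpose (\<alpha> x) = \<alpha> x"
    then show "(\<alpha> x *v fst q x) \<bullet> fst v x = (\<alpha> x *v fst v x) \<bullet> fst q x"
      by (metis dot_lmul_matrix inner_commute transpose_matrix_vector)
  qed
qed (use wip_integrable assms borel_measurable_integrable in blast)+

lemma poly_field_zero_of_integral_square:
  assumes G: "\<And>i. (\<lambda>x. G x $ i) \<in> polys k T" and z: "(LINT x|M. (G x :: real^'n) \<bullet> G x) = 0"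
  shows "G = (\<lambda>x. 0)"
proof -
  have "integrable M (\<lambda>x. G x \<bullet> G x)"
    by (intro M_integrable bdd_borel_inner polys_T_bdd[OF G])
  then have "AE x in M. G x \<bullet> G x = 0"
    using z by (subst (asm) integral_nonneg_eq_0_iff_AE) auto
  then have "AE x in M. G x $ i = 0" for i by (rule AE_mp) auto
  then have "(\<lambda>x. G x $ i) = (\<lambda>x. 0)" for i by (rule polys_AE_zero[OF G T_closure])
  then show ?thesis by (simp add: fun_eq_iff vec_eq_iff)
qed

lemma wip_definite:
  assumes "q \<in> V" shows "0 \<le> wip q q" "wip q q = 0 \<Longrightarrow> fst q = (\<lambda>x. 0)"
proof -
  obtain c where c: "c > 0" and AE: "AE x in M. \<forall>\<xi>. c * (norm \<xi>)\<^sup>2 \<le> \<xi> \<bullet> (\<alpha> x *v \<xi>)"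
    using coeff_coercive by blast
  have int: "integrable M (\<lambda>x. fst q x \<bullet> fst q x)"
    by (intro M_integrable bdd_borel_inner polys_T_bdd[OF V_interior[OF assms]])
  have "(LINT x|M. c * (fst q x \<bullet> fst q x)) \<le> (LINT x|M. (\<alpha> x *v fst q x) \<bullet> fst q x)"
  proof (rule integral_mono_AE[OF _ wip_integrable[OF assms assms]])
    show "integrable M (\<lambda>x. c * (fst q x \<bullet> fst q x))" using int by simp
    show "AE x in M. c * (fst q x \<bullet> fst q x) \<le> (\<alpha> x *v fst q x) \<bullet> fst q x"
      by (rule AE_mp[OF AE]) (auto intro!: AE_I2 simp: power2_norm_eq_inner inner_commute)
  qed
  then have le: "c * (LINT x|M. fst q x \<bullet> fst q x) \<le> wip q q"
    by (simp add: wip_def ipv_eq)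
  have ge: "0 \<le> (LINT x|M. fst q x \<bullet> fst q x)" by (intro integral_nonneg_AE) auto
  show "0 \<le> wip q q" using le ge c by (smt (verit) mult_nonneg_nonneg)
  show "fst q = (\<lambda>x. 0)" if "wip q q = 0"
  proof (rule poly_field_zero_of_integral_square[OF V_interior[OF assms]])
    show "(LINT x|M. fst q x \<bullet> fst q x) = 0"
      using le ge c that by (simp add: mult_le_0_iff)
  qed
qed

section \<open>The discrete weak divergence\<close>

text \<open>The functional that the weak divergence of \<open>v\<close> represents.\<close>

definition wdiv :: "'n weak_field \<Rightarrow> (real^'n \<Rightarrow> real) \<Rightarrow> real" where
  "wdiv v \<phi> = - ipv T (fst v) (grad \<phi>) + bip Eh T (normal_trace T v) (\<lambda>e. \<phi>)"

text \<open>The gradient of a function cut off at the boundary of \<open>T\<close> is arbitrary there; only its values in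
  the interior enter the integral.\<close>

lemma ipv_grad_eq:
  assumes "\<And>x. x \<in> interior T \<Longrightarrow> GDERIV \<phi> x :> G x"
  shows "ipv T v (grad \<phi>) = (LINT x|M. v x \<bullet> G x)"
  unfolding ipv_eq
  by (rule Bochner_Integration.integral_cong[OF refl]) (simp add: space_M grad_eq[OF assms])

lemma wdiv_linear1:
  assumes "v \<in> V" "v' \<in> V" "\<phi> \<in> W"
  shows "wdiv (lin_field r v v') \<phi> = r * wdiv v \<phi> + wdiv v' \<phi>"
proof -
  obtain G where G: "\<And>i. (\<lambda>x. G x $ i) \<in> polys k T"
    "\<And>x. x \<in> interior T \<Longrightarrow> GDERIV \<phi> x :> G x"
    using polys_gradient[OF assms(3)] by blast
  have int: "integrable M (\<lambda>x. fst v x \<bullet> G x)" if "v \<in> V" for v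
    by (intro M_integrable bdd_borel_inner polys_T_bdd[OF G(1)] polys_T_bdd[OF V_interior[OF that]])
  have "ipv T (fst (lin_field r v v')) (grad \<phi>) = r * ipv T (fst v) (grad \<phi>) + ipv T (fst v') (grad \<phi>)"
    using int[OF assms(1)] int[OF assms(2)]
    by (simp add: ipv_grad_eq[OF G(2)] lin_field_def inner_add_left)
  moreover have "bip Eh T (normal_trace T (lin_field r v v')) (\<lambda>e. \<phi>) =
      r * bip Eh T (normal_trace T v) (\<lambda>e. \<phi>) + bip Eh T (normal_trace T v') (\<lambda>e. \<phi>)"
    unfolding normal_trace_lin
    by (intro bip_linear bdd_faces_normal_trace bdd_faces_W assms)
  ultimately show ?thesis by (simp add: wdiv_def algebra_simps)
qed

lemma wdiv_linear2:
  assumes "v \<in> V" "\<phi> \<in> W" "\<psi> \<in> W"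
  shows "wdiv v (\<lambda>x. r * \<phi> x + \<psi> x) = r * wdiv v \<phi> + wdiv v \<psi>"
proof -
  obtain G where G: "\<And>i. (\<lambda>x. G x $ i) \<in> polys k T"
    "\<And>x. x \<in> interior T \<Longrightarrow> GDERIV \<phi> x :> G x"
    using polys_gradient[OF assms(2)] by blast
  obtain H where H: "\<And>i. (\<lambda>x. H x $ i) \<in> polys k T"
    "\<And>x. x \<in> interior T \<Longrightarrow> GDERIV \<psi> x :> H x"
    using polys_gradient[OF assms(3)] by blast
  have GH: "GDERIV (\<lambda>x. r * \<phi> x + \<psi> x) x :> r *\<^sub>R G x + H x" if "x \<in> interior T" for x
    using has_derivative_add[OF has_derivative_mult_right[OF G(2)[OF that, unfolded gderiv_def], of r]
        H(2)[OF that, unfolded gderiv_def]]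
    by (simp add: gderiv_def inner_add_right)
  have int: "integrable M (\<lambda>x. fst v x \<bullet> F x)" if "\<And>i. (\<lambda>x. F x $ i) \<in> polys k T" for F
    by (intro M_integrable bdd_borel_inner polys_T_bdd[OF that] polys_T_bdd[OF V_interior[OF assms(1)]])
  have "ipv T (fst v) (grad (\<lambda>x. r * \<phi> x + \<psi> x)) =
      r * ipv T (fst v) (grad \<phi>) + ipv T (fst v) (grad \<psi>)"
    using int[OF G(1)] int[OF H(1)]
    by (simp add: ipv_grad_eq[OF G(2)] ipv_grad_eq[OF H(2)] ipv_grad_eq[OF GH] inner_add_right)
  moreover have "bip Eh T (normal_trace T v) (\<lambda>e x. r * \<phi> x + \<psi> x) =
      r * bip Eh T (normal_trace T v) (\<lambda>e. \<phi>) + bip Eh T (normal_trace T v) (\<lambda>e. \<psi>)"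
    using bip_linear[OF bdd_faces_W[OF assms(2)] bdd_faces_W[OF assms(3)]
        bdd_faces_normal_trace[OF assms(1)], of r]
    by (simp add: bip_commute)
  ultimately show ?thesis by (simp add: wdiv_def algebra_simps)
qed

lemma ip_linear:
  assumes "p \<in> W" "q \<in> W" "\<phi> \<in> W"
  shows "ip T (\<lambda>x. r * p x + q x) \<phi> = r * ip T p \<phi> + ip T q \<phi>"
proof -
  have "integrable M (\<lambda>x. p x * \<phi> x)" "integrable M (\<lambda>x. q x * \<phi> x)"
    by (intro M_integrable bdd_borel_mult W_bdd assms)+
  then show ?thesis by (simp add: ip_eq distrib_right mult.assoc)
qed

lemma ip_commute: "ip D f g = ip D g f"
  by (simp add: ip_def mult.commute)

lemma ip_definite:
  assumes "p \<in> W" "ip T p p = 0" shows "p = (\<lambda>x. 0)"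
proof (rule polys_AE_zero[OF assms(1) T_closure])
  have "integrable M (\<lambda>x. p x * p x)" by (intro M_integrable bdd_borel_mult W_bdd assms)
  then show "AE x in M. p x = 0"
    using assms(2) unfolding ip_eq by (subst (asm) integral_nonneg_eq_0_iff_AE) auto
qed

lemma wdiv_zero: "v \<in> V \<Longrightarrow> wdiv v (\<lambda>x. 0) = 0"
  using wdiv_linear2[of v "\<lambda>x. 0" "\<lambda>x. 0" 1] by (simp add: polys_zero)

text \<open>Riesz representation on \<open>W\<close> with the \<open>L\<^sup>2\<close> inner product.\<close>

lemma weak_div_exists1:
  assumes v: "v \<in> V"
  shows "\<exists>!p. p \<in> W \<and> (\<forall>\<phi>\<in>W. ip T p \<phi> = wdiv v \<phi>)"
proof (rule ex_ex1I)
  define P where "P = poly_on (k + 1) T"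
  have P: "P c \<in> W" for c by (simp add: P_def polys_eq_range)
  have P_linear: "P (\<lambda>m. r * c m + d m) = (\<lambda>x. r * P c x + P d x)" for r c d
    by (simp add: P_def poly_on_linear)
  have "\<exists>c. \<forall>d. ip T (P c) (P d) = wdiv v (P d)"
  proof (rule bilinear_system_solvable[OF finite_degs])
    show "linear_functional (\<lambda>c. ip T (P c) (P d))" for d
      by (simp add: linear_functional_def P_linear ip_linear P del: One_nat_def)
    then show "linear_functional (\<lambda>d. ip T (P c) (P d))" for c
      by (simp add: ip_commute[of T "P c"])
    show "linear_functional (\<lambda>d. wdiv v (P d))"
      by (simp add: linear_functional_def P_linear wdiv_linear2 P v del: One_nat_def)
    show "ip T (P c) (P d) = ip T (P c') (P d)"
      if "\<And>m. m \<in> degs (k + 1) \<Longrightarrow> c m = c' m" for c c' d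
      using poly_on_cong[of "k + 1" c c' T] that by (simp add: P_def)
    show "wdiv v (P d) = 0" if "\<And>c. ip T (P c) (P d) = 0" for d
      using ip_definite[OF P that] wdiv_zero[OF v] by simp
  qed
  then show "\<exists>p. p \<in> W \<and> (\<forall>\<phi>\<in>W. ip T p \<phi> = wdiv v \<phi>)"
    using P by (auto simp: P_def polys_eq_range)
  fix p p'
  assume p: "p \<in> W \<and> (\<forall>\<phi>\<in>W. ip T p \<phi> = wdiv v \<phi>)"
    and p': "p' \<in> W \<and> (\<forall>\<phi>\<in>W. ip T p' \<phi> = wdiv v \<phi>)"
  let ?d = "\<lambda>x. (-1) * p' x + p x"
  have d: "?d \<in> W" using p p' by (intro polys_linear) auto
  have "ip T ?d ?d = 0"
    by (subst ip_linear) (use p p' d in auto)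
  then show "p = p'" using ip_definite[OF d] by (simp add: fun_eq_iff)
qed

lemma ip_weak_div:
  assumes "v \<in> V" "\<phi> \<in> W" shows "ip T (weak_div Eh k T v) \<phi> = wdiv v \<phi>"
  using theI'[OF weak_div_exists1[OF assms(1)]] assms(2)
  by (simp add: weak_div_def wdiv_def)


section \<open>Well-posedness of the local problem\<close>

text \<open>The weak field with given coefficients, first those of the components on \<open>T\<close>, then
  those of one polynomial on each face.\<close>

definition field_of ::
  "('n \<times> ('n \<Rightarrow> nat) + (real^'n) set \<times> ('n \<Rightarrow> nat) \<Rightarrow> real) \<Rightarrow> 'n weak_field" where
  "field_of c =
    ((\<lambda>x. \<chi> i. poly_on k T (\<lambda>m. c (Inl (i, m))) x),
     (\<lambda>e x. if e \<in> faces Eh T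
            then poly_on k e (\<lambda>m. c (Inr (e, m))) x *\<^sub>R outward_normal T e else 0))"

text \<open>The finitely many coefficients on which \<open>field_of\<close> depends.\<close>

definition field_indices :: "('n \<times> ('n \<Rightarrow> nat) + (real^'n) set \<times> ('n \<Rightarrow> nat)) set" where
  "field_indices = Inl ` (UNIV \<times> degs k) \<union> Inr ` (faces Eh T \<times> degs k)"

lemma finite_field_indices: "finite field_indices"
  by (simp add: field_indices_def finite_degs finite_faces)

lemma V_eq_range: "V = range field_of"
proof
  show "range field_of \<subseteq> V"
    by (auto simp: V_space_def field_of_def polys_eq_range)
  show "V \<subseteq> range field_of"
  proof
    fix v assume v: "v \<in> V"
    have "\<forall>i. \<exists>c. (\<lambda>x. fst v x $ i) = poly_on k T c"
      using V_interior[OF v] by (auto simp: polys_eq_range)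
    then obtain a where a: "\<And>i. (\<lambda>x. fst v x $ i) = poly_on k T (a i)" by metis
    have "\<forall>e\<in>faces Eh T. \<exists>c. snd v e = (\<lambda>x. poly_on k e c x *\<^sub>R outward_normal T e)"
      using v by (force simp: V_space_def polys_eq_range)
    then obtain b where b: "\<And>e. e \<in> faces Eh T \<Longrightarrow>
        snd v e = (\<lambda>x. poly_on k e (b e) x *\<^sub>R outward_normal T e)" by metis
    have "snd v e = (\<lambda>x. 0)" if "e \<notin> faces Eh T" for e
      using v that by (auto simp: V_space_def)
    then have "v = field_of (case_sum (\<lambda>(i, m). a i m) (\<lambda>(e, m). b e m))"
      using a b by (auto simp: field_of_def prod_eq_iff fun_eq_iff vec_eq_iff)
    then show "v \<in> range field_of" by blast
  qed
qed

lemma field_of_linear: "field_of (\<lambda>j. r * c j + d j) = lin_field r (field_of c) (field_of d)"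
proof (rule prod_eqI)
  show "fst (field_of (\<lambda>j. r * c j + d j)) = fst (lin_field r (field_of c) (field_of d))"
    by (rule ext) (simp add: field_of_def lin_field_def vec_eq_iff poly_on_linear)
  show "snd (field_of (\<lambda>j. r * c j + d j)) = snd (lin_field r (field_of c) (field_of d))"
    by (intro ext) (simp add: field_of_def lin_field_def poly_on_linear scaleR_left_distrib)
qed

lemma field_of_cong:
  assumes "\<And>j. j \<in> field_indices \<Longrightarrow> c j = d j" shows "field_of c = field_of d"
proof -
  have "poly_on k T (\<lambda>m. c (Inl (i, m))) = poly_on k T (\<lambda>m. d (Inl (i, m)))" for i
    by (rule poly_on_cong) (auto intro!: assms simp: field_indices_def)
  moreover have "poly_on k e (\<lambda>m. c (Inr (e, m))) = poly_on k e (\<lambda>m. d (Inr (e, m)))"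
    if "e \<in> faces Eh T" for e
    by (rule poly_on_cong) (auto intro!: assms simp: field_indices_def that)
  ultimately show ?thesis by (auto simp: field_of_def fun_eq_iff)
qed

lemma V_lin_field: "v \<in> V \<Longrightarrow> v' \<in> V \<Longrightarrow> lin_field r v v' \<in> V"
  unfolding V_eq_range by (auto simp: field_of_linear[symmetric])

text \<open>The energy is definite: coercivity gives \<open>v\<^sub>0 = 0\<close>, and then the stabilizer gives \<open>v\<^sub>b = 0\<close>.\<close>

lemma energy_definite:
  assumes v: "v \<in> V" and z: "stab Eh T v v + wip v v = 0"
  shows "fst v = (\<lambda>x. 0)" "snd v = (\<lambda>e x. 0)"
proof -
  have "0 \<le> stab Eh T v v"
    unfolding stab_eq using bip_nonneg diameter_pos by (intro mult_nonneg_nonneg) auto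
  then have "stab Eh T v v = 0" "wip v v = 0" using z wip_definite(1)[OF v] by linarith+
  then have b: "bip Eh T (jump v) (jump v) = 0" and v0: "fst v = (\<lambda>x. 0)"
    using diameter_pos wip_definite(2)[OF v] by (auto simp: stab_eq)
  show "fst v = (\<lambda>x. 0)" by (rule v0)
  show "snd v = (\<lambda>e x. 0)"
  proof
    fix e
    show "snd v e = (\<lambda>x. 0)"
    proof (cases "e \<in> faces Eh T")
      case e: True
      obtain w where w: "w \<in> polys k e" "snd v e = (\<lambda>x. w x *\<^sub>R outward_normal T e)"
        "normal_trace T v e = w" using V_face[OF v e] by blast
      have "AE x in face_measure e. jump v e x = 0"
        by (rule bip_eq_0D[OF bdd_faces_jump[OF v] b e])
      then have "AE x in face_measure e. w x = 0" by (simp add: jump_eq v0 w(3))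
      then have "w = (\<lambda>x. 0)"
        using polys_face_AE_zero[OF w(1)] face_compact face_nonempty face_closure e by blast
      then show ?thesis using w(2) by simp
    qed (use v in \<open>auto simp: V_space_def\<close>)
  qed
qed

text \<open>
  The weak divergence maps onto \<open>W\<close>: a polynomial orthogonal to its range has zero gradient (test with
  \<open>v\<^sub>0\<close> equal to the gradient), so it is constant on the connected element, and then it vanishes (test
  with \<open>v\<^sub>b\<close> equal to the normal of one face).
\<close>

lemma wdiv_kernel:
  assumes u: "u \<in> W" and z: "\<And>v. v \<in> V \<Longrightarrow> wdiv v u = 0"
  shows "u = (\<lambda>x. 0)"
proof -
  obtain G where G: "\<And>i. (\<lambda>x. G x $ i) \<in> polys k T"
    "\<And>x. x \<in> interior T \<Longrightarrow> GDERIV u x :> G x"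
    using polys_gradient[OF u] by blast
  have "(G, \<lambda>e x. 0) \<in> V"
    using G(1) by (force simp: V_space_def intro: polys_zero)
  from z[OF this] have "(LINT x|M. G x \<bullet> G x) = 0"
    by (simp add: wdiv_def ipv_grad_eq[OF G(2)] bip_def normal_trace_def)
  then have "G = (\<lambda>x. 0)" by (rule poly_field_zero_of_integral_square[OF G(1)])
  then have "(u has_derivative (\<lambda>h. 0)) (at x within interior T)" if "x \<in> interior T" for x
    using G(2)[OF that] by (simp add: gderiv_def has_derivative_at_withinI)
  then have "u constant_on interior T"
    using continuous_on_subset[OF polys_continuous_on[OF u] interior_subset]
    by (intro has_derivative_zero_connected_constant_on[where K = "{}"] T_connected) auto
  then obtain a where a: "\<And>x. x \<in> interior T \<Longrightarrow> u x = a" by (auto simp: constant_on_def)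
  let ?d = "\<lambda>x. u x - (if x \<in> T then a else 0)"
  have "?d \<in> W" by (intro polys_diff u polys_const)
  then have "?d = (\<lambda>x. 0)"
    by (rule polys_eq_zeroI[OF _ _ interior_subset T_closure]) (use a interior_subset in auto)
  then have ua: "u x = (if x \<in> T then a else 0)" for x
    by (drule_tac x = x in fun_cong) simp
  obtain e where e: "e \<in> faces Eh T" using faces_nonempty by blast
  let ?one = "\<lambda>x. if x \<in> e then 1 else (0::real)"
  let ?v = "(\<lambda>x. 0, \<lambda>e' x. if e' = e then ?one x *\<^sub>R outward_normal T e else 0) :: 'n weak_field"
  have one: "?one \<in> polys k e" by (rule polys_const)
  have v: "?v \<in> V"
  proof -
    have "\<exists>w\<in>polys k e'. snd ?v e' = (\<lambda>x. w x *\<^sub>R outward_normal T e')" for e'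
    proof (cases "e' = e")
      case True
      then show ?thesis using one by (intro bexI[of _ ?one]) auto
    next
      case False
      then show ?thesis by (intro bexI[of _ "\<lambda>x. 0"]) (auto simp: polys_zero)
    qed
    then show ?thesis using e by (auto simp: V_space_def polys_zero)
  qed
  have nt: "normal_trace T ?v e' x = (if e' = e then ?one x else 0)" for e' x
    using normal_unit[OF e] by (auto simp: normal_trace_def norm_eq_1)
  have "wdiv ?v u = (LINT x|face_measure e. a * ?one x)"
  proof -
    have "bip Eh T (normal_trace T ?v) (\<lambda>e. u) =
        (\<Sum>e'\<in>faces Eh T. if e = e' then LINT x|face_measure e. ?one x * u x else 0)"
      unfolding bip_def by (intro sum.cong refl) (auto simp: nt)
    also have "\<dots> = (LINT x|face_measure e. ?one x * u x)"
      using e by (simp add: finite_faces)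
    also have "\<dots> = (LINT x|face_measure e. a * ?one x)"
      using face_subset[OF e] by (intro Bochner_Integration.integral_cong) (auto simp: ua)
    finally show ?thesis by (simp add: wdiv_def ipv_eq)
  qed
  then have "a * (LINT x|face_measure e. ?one x) = 0" using z[OF v] by simp
  moreover have "(LINT x|face_measure e. ?one x) \<noteq> 0"
  proof
    assume 0: "(LINT x|face_measure e. ?one x) = 0"
    have "integrable (face_measure e) ?one"
      using polys_bdd_borel[OF one] bdd_borel_integrable_face face_compact face_nonempty e by blast
    then have "AE x in face_measure e. ?one x = 0"
      using 0 by (subst (asm) integral_nonneg_eq_0_iff_AE) auto
    then have "?one = (\<lambda>x. 0)"
      using polys_face_AE_zero[OF one] face_compact face_nonempty face_closure e by blast
    then show False using face_nonempty[OF e] by (metis ex_in_conv zero_neq_one)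
  qed
  ultimately have "a = 0" by simp
  then show ?thesis using ua by auto
qed

lemma flux_equation_iff:
  assumes "u \<in> W"
  shows "flux_equation Eh k \<alpha> T \<theta> q u \<longleftrightarrow>
    (\<forall>v\<in>V. stab Eh T q v + wip q v - wdiv v u = - bip Eh T \<theta> (normal_trace T v))"
  unfolding flux_equation_def wip_def by (simp add: ip_weak_div[OF _ assms])

text \<open>The local problem with data \<open>\<theta>\<close>, with the weak divergence eliminated from both equations.\<close>

definition local_solution ::
  "((real^'n) set \<Rightarrow> real^'n \<Rightarrow> real) \<Rightarrow> 'n weak_field \<Rightarrow> (real^'n \<Rightarrow> real) \<Rightarrow> bool" where
  "local_solution \<theta> q u \<longleftrightarrow> q \<in> V \<and> u \<in> W \<and>
     (\<forall>v\<in>V. stab Eh T q v + wip q v - wdiv v u = - bip Eh T \<theta> (normal_trace T v)) \<and>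
     (\<forall>w\<in>W. wdiv q w = 0)"

lemma local_solution_unique:
  assumes 1: "local_solution \<theta> q u" and 2: "local_solution \<theta> q' u'"
  shows "q = q' \<and> u = u'"
proof -
  have mem: "q \<in> V" "q' \<in> V" "u \<in> W" "u' \<in> W" using 1 2 by (auto simp: local_solution_def)
  define p where "p = lin_field (-1) q' q"
  define y where "y = (\<lambda>x. (-1) * u' x + u x)"
  have p: "p \<in> V" unfolding p_def by (intro V_lin_field mem)
  have y: "y \<in> W" unfolding y_def by (intro polys_linear mem)
  have eq: "stab Eh T p v + wip p v - wdiv v y = 0" if v: "v \<in> V" for v
  proof -
    have "stab Eh T q v + wip q v - wdiv v u = stab Eh T q' v + wip q' v - wdiv v u'"
      using 1 2 v by (simp add: local_solution_def)
    then show ?thesis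
      using stab_linear[OF mem(2,1) v, of "-1"] wip_linear[OF mem(2,1) v, of "-1"]
        wdiv_linear2[OF v mem(4,3), of "-1"] by (simp add: p_def y_def)
  qed
  have "wdiv p y = 0"
    using wdiv_linear1[OF mem(2,1) y, of "-1"] 1 2 y by (simp add: p_def local_solution_def)
  then have "stab Eh T p p + wip p p = 0" using eq[OF p] by simp
  note p0 = energy_definite[OF p this]
  have "wdiv v y = 0" if v: "v \<in> V" for v
  proof -
    have "stab Eh T p v + wip p v = 0"
      using p0 by (simp add: stab_eq wip_def ipv_eq jump_def bip_def)
    then show ?thesis using eq[OF v] by simp
  qed
  then have "y = (\<lambda>x. 0)" by (rule wdiv_kernel[OF y])
  moreover have "q = q'"
    using p0 by (auto simp: p_def lin_field_def prod_eq_iff fun_eq_iff)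
  ultimately show ?thesis by (auto simp: y_def fun_eq_iff)
qed

text \<open>
  Existence.  The two equations are written as one symmetric system
  \<open>B (q, u) (v, w) = L (v, w)\<close>.  Testing a kernel element \<open>(v, w)\<close> against \<open>(v, -w)\<close> gives \<open>v = 0\<close>,
  and the right-hand side involves \<open>v\<close> only.
\<close>

lemma local_solution_exists:
  assumes \<theta>: "bdd_faces \<theta>"
  shows "\<exists>q u. local_solution \<theta> q u"
proof -
  define P where "P c = poly_on (k + 1) T (\<lambda>m. c (Inr m))"
    for c :: "('n \<times> ('n \<Rightarrow> nat) + (real^'n) set \<times> ('n \<Rightarrow> nat)) + ('n \<Rightarrow> nat) \<Rightarrow> real"
  define F where "F c = field_of (\<lambda>j. c (Inl j))"
    for c :: "('n \<times> ('n \<Rightarrow> nat) + (real^'n) set \<times> ('n \<Rightarrow> nat)) + ('n \<Rightarrow> nat) \<Rightarrow> real"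
  have P: "P c \<in> W" for c by (simp add: P_def polys_eq_range)
  have F: "F c \<in> V" for c by (simp add: F_def V_eq_range)
  have P_lin: "P (\<lambda>j. r * c j + d j) = (\<lambda>x. r * P c x + P d x)" for r c d
    by (simp add: P_def poly_on_linear)
  have F_lin: "F (\<lambda>j. r * c j + d j) = lin_field r (F c) (F d)" for r c d
    by (simp add: F_def field_of_linear)
  have surj: "\<exists>c. F c = v \<and> P c = w" if vw: "v \<in> V" "w \<in> W" for v w
  proof -
    obtain a where a: "v = field_of a" using vw by (auto simp: V_eq_range)
    obtain b where b: "w = poly_on (k + 1) T b" using vw(2) unfolding polys_eq_range by blast
    show ?thesis by (rule exI[of _ "case_sum a b"]) (simp add: F_def P_def a b)
  qed
  define B where "B c d =
    stab Eh T (F c) (F d) + wip (F c) (F d) - wdiv (F d) (P c) - wdiv (F c) (P d)" for c d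
  define L where "L d = - bip Eh T \<theta> (normal_trace T (F d))" for d
  have B_commute: "B c d = B d c" for c d
    by (simp add: B_def stab_commute[of "F c"] wip_commute[OF F F, of c])
  have B_lin: "linear_functional (\<lambda>c. B c d)" for d
    unfolding linear_functional_def B_def F_lin P_lin stab_linear[OF F F F] wip_linear[OF F F F]
      wdiv_linear1[OF F F P] wdiv_linear2[OF F P P]
    by (simp add: algebra_simps)
  have "\<exists>c. \<forall>d. B c d = L d"
  proof (rule bilinear_system_solvable)
    show "finite (Inl ` field_indices \<union> Inr ` degs (k + 1))"
      by (simp add: finite_field_indices finite_degs)
    show "linear_functional (\<lambda>c. B c d)" for d by (rule B_lin)
    show "linear_functional (B c)" for c
      using B_lin[of c] by (simp add: B_commute[of _ c])
    show "linear_functional L"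
      unfolding linear_functional_def L_def F_lin normal_trace_lin bip_commute[of \<theta>]
      by (simp add: bip_linear bdd_faces_normal_trace F \<theta>)
    show "B c d = B c' d"
      if "\<And>j. j \<in> Inl ` field_indices \<union> Inr ` degs (k + 1) \<Longrightarrow> c j = c' j" for c c' d
    proof -
      have "F c = F c'" unfolding F_def by (rule field_of_cong) (simp add: that)
      moreover have "P c = P c'" unfolding P_def by (rule poly_on_cong) (simp add: that)
      ultimately show ?thesis by (simp add: B_def)
    qed
    show "L d = 0" if z: "\<And>c. B c d = 0" for d
    proof -
      have "(\<lambda>x. (-1) * P d x) \<in> W" by (intro polys_scale P)
      then obtain c where c: "F c = F d" "P c = (\<lambda>x. (-1) * P d x + 0)"
        using surj[OF F] by force
      have "wdiv (F d) (P c) = - wdiv (F d) (P d)"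
        unfolding c by (subst wdiv_linear2[OF F P polys_zero]) (simp add: wdiv_zero[OF F])
      then have "stab Eh T (F d) (F d) + wip (F d) (F d) = 0"
        using z[of c] by (simp add: B_def c(1))
      from energy_definite[OF F this] show ?thesis
        by (simp add: L_def bip_def normal_trace_def)
    qed
  qed
  then obtain c where c: "\<And>d. B c d = L d" by blast
  have eq: "stab Eh T (F c) v + wip (F c) v - wdiv v (P c) - wdiv (F c) w
      = - bip Eh T \<theta> (normal_trace T v)" if vw: "v \<in> V" "w \<in> W" for v w
  proof -
    obtain d where "F d = v" "P d = w" using surj[OF vw] by blast
    then show ?thesis using c[of d] by (simp add: B_def L_def)
  qed
  have 1: "stab Eh T (F c) v + wip (F c) v - wdiv v (P c) = - bip Eh T \<theta> (normal_trace T v)"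
    if v: "v \<in> V" for v
    using eq[OF v polys_zero] wdiv_zero[OF F] by simp
  have "wdiv (F c) w = 0" if w: "w \<in> W" for w
    using eq[OF F[of c] w] 1[OF F[of c]] by simp
  with 1 have "local_solution \<theta> (F c) (P c)" unfolding local_solution_def using F P by blast
  then show ?thesis by blast
qed

lemma H_local_solution:
  assumes "bdd_faces \<theta>"
  shows "local_solution \<theta> (Hq Eh k \<alpha> \<theta> T) (Hu Eh k \<alpha> \<theta> T)"
proof -
  have iff: "(q \<in> V \<and> u \<in> W_space k T \<and> flux_equation Eh k \<alpha> T \<theta> q u \<and>
      (\<forall>w\<in>W_space k T. ip T (weak_div Eh k T q) w = 0)) \<longleftrightarrow> local_solution \<theta> q u" for q u
    unfolding local_solution_def W_space_def using flux_equation_iff ip_weak_div by metis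
  define z where "z = (THE (q, u). local_solution \<theta> q u)"
  have "\<exists>!z. case z of (q, u) \<Rightarrow> local_solution \<theta> q u"
    using local_solution_exists[OF assms] local_solution_unique by fast
  then have "case z of (q, u) \<Rightarrow> local_solution \<theta> q u" unfolding z_def by (rule theI')
  then show ?thesis
    unfolding Hq_def Hu_def H_local_def iff z_def[symmetric] by (cases z) simp
qed

text \<open>
  The identity on one element from which the reduced problem follows by summation.  It equates the flux
  equations of \<open>\<theta>\<close> for the homogeneous and the given local solution, both tested with the weakly
  divergence-free field of \<open>\<phi>\<close>, and then tests the flux equation of \<open>\<phi>\<close> with \<open>q\<close>.
\<close>

lemma local_identity:
  assumes \<theta>: "bdd_faces \<theta>" and \<phi>: "bdd_faces \<phi>"
    and q: "q \<in> V" and u: "u \<in> W" and flux: "flux_equation Eh k \<alpha> T \<theta> q u"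
    and div: "\<And>w. w \<in> W \<Longrightarrow> ip T (weak_div Eh k T q) w = ip T f w"
  shows "stab Eh T (Hq Eh k \<alpha> \<theta> T) (Hq Eh k \<alpha> \<phi> T) +
      ipv T (\<lambda>x. \<alpha> x *v H0 Eh k \<alpha> \<theta> T x) (H0 Eh k \<alpha> \<phi> T)
    = ip T f (Hu Eh k \<alpha> \<phi> T) - bip Eh T (normal_trace T q) \<phi>"
proof -
  let ?q = "Hq Eh k \<alpha> \<theta> T" and ?u = "Hu Eh k \<alpha> \<theta> T"
  let ?p = "Hq Eh k \<alpha> \<phi> T" and ?y = "Hu Eh k \<alpha> \<phi> T"
  note sol\<theta> = H_local_solution[OF \<theta>, unfolded local_solution_def]
  note sol\<phi> = H_local_solution[OF \<phi>, unfolded local_solution_def]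
  have p: "?p \<in> V" and y: "?y \<in> W" using sol\<phi> by auto
  have "stab Eh T ?q ?p + wip ?q ?p = - bip Eh T \<theta> (normal_trace T ?p)"
    using sol\<theta> sol\<phi> by fastforce
  also have "\<dots> = stab Eh T q ?p + wip q ?p"
    using flux[unfolded flux_equation_iff[OF u]] sol\<phi> u by fastforce
  also have "\<dots> = stab Eh T ?p q + wip ?p q"
    using wip_commute[OF q p] by (simp add: stab_commute)
  also have "\<dots> = wdiv q ?y - bip Eh T \<phi> (normal_trace T q)"
    using sol\<phi> q by fastforce
  also have "wdiv q ?y = ip T f ?y"
    using ip_weak_div[OF q y] div[OF y] by simp
  finally show ?thesis by (simp add: wip_def H0_def[abs_def] bip_commute)
qed

end

section \<open>Elements of a polytopal mesh\<close>

lemma AE_lebesgue_on_subset: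
  assumes "AE x in lebesgue_on S. P x" "U \<subseteq> S" "S \<in> sets lebesgue" "U \<in> sets lebesgue"
  shows "AE x in lebesgue_on U. P x"
proof -
  have "AE x\<in>S in lebesgue. P x" using assms by (simp add: AE_restrict_space_iff)
  then have "AE x\<in>U in lebesgue. P x" by (rule AE_mp) (use assms(2) in auto)
  then show ?thesis using assms by (simp add: AE_restrict_space_iff)
qed

lemma mesh_element_of_mesh:
  fixes \<Omega> :: "(real^'n) set"
  assumes mesh: "polytopal_mesh \<Omega> Th Eh" and dom: "open \<Omega>"
    and coeff: "admissible_coefficient \<Omega> \<alpha>" and T: "T \<in> Th"
  shows "mesh_element Eh T \<alpha>"
proof -
  have poly: "polytopal (int CARD('n)) T" and sub: "interior T \<subseteq> \<Omega>" and fin: "finite Eh"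
    and front: "frontier T = \<Union>(faces Eh T)"
    and ex: "\<And>e. e \<in> faces Eh T \<Longrightarrow> \<exists>n. is_outward_normal T e n"
    and face: "\<And>e. e \<in> faces Eh T \<Longrightarrow> polytopal (int CARD('n) - 1) e"
    using mesh T by (auto simp: polytopal_mesh_def faces_def)
  have fine: "finite (faces Eh T)" using fin by (simp add: faces_def)
  have int: "rel_interior T = interior T"
    using poly by (intro interior_rel_interior) (simp add: polytopal_def)
  have comp: "compact T" by (rule polytopal_compact[OF poly])
  have clos: "T \<subseteq> closure (interior T)"
    using polytopal_subset_closure_rel_interior[OF poly] by (simp add: int)
  have "T \<noteq> {}" using poly by (auto simp: polytopal_def)
  then have int_ne: "interior T \<noteq> {}" using clos by auto
  have e_ne: "e \<noteq> {}" if e: "e \<in> faces Eh T" for e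
  proof
    assume "e = {}"
    then have "(0::int) = int CARD('n)" using face[OF e] by (simp add: polytopal_def)
    then show False by simp
  qed
  have normal: "is_outward_normal T e (outward_normal T e)" if e: "e \<in> faces Eh T" for e
    using ex[OF e] outward_normal_eq[OF face[OF e] e_ne[OF e]] by metis
  have negl: "negligible (frontier T)"
    unfolding front
  proof (rule negligible_Union[OF fine])
    fix e assume "e \<in> faces Eh T"
    then show "negligible e"
      using normal[of e] by (intro negligible_of_normal) (auto simp: is_outward_normal_def)
  qed
  have sets: "\<Omega> \<in> sets lebesgue" "interior T \<in> sets lebesgue"
    using dom by auto
  note AE_sub = AE_lebesgue_on_subset[OF _ sub sets]
  show ?thesis
  proof
    show "finite (faces Eh T)" by (rule fine)
    show "faces Eh T \<noteq> {}"
      using front frontier_eq_empty[of T] \<open>T \<noteq> {}\<close> comp not_compact_UNIV by auto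
    show "compact e" "e \<noteq> {}" "e \<subseteq> closure (rel_interior e)" "norm (outward_normal T e) = 1"
      if "e \<in> faces Eh T" for e
      using polytopal_compact[OF face[OF that]] e_ne[OF that] normal[OF that]
        polytopal_subset_closure_rel_interior[OF face[OF that]]
      by (simp_all add: is_outward_normal_def)
    show "connected (interior T)" using poly int by (simp add: polytopal_def)
    show "\<alpha> \<in> borel_measurable (lebesgue_on (interior T))"
      using coeff sub by (auto simp: admissible_coefficient_def intro: measurable_restrict_mono)
    show "\<exists>C. AE x in lebesgue_on (interior T). norm (\<alpha> x) \<le> C"
      "AE x in lebesgue_on (interior T). transpose (\<alpha> x) = \<alpha> x"
      "\<exists>c>0. AE x in lebesgue_on (interior T). \<forall>\<xi>. c * (norm \<xi>)\<^sup>2 \<le> \<xi> \<bullet> (\<alpha> x *v \<xi>)"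
      using coeff AE_sub unfolding admissible_coefficient_def by blast+
  qed (fact comp clos int_ne negl)+
qed

lemma square_integrable_times_bdd:
  assumes f: "square_integrable (lebesgue_on \<Omega>) f" and \<Omega>: "\<Omega> \<in> lmeasurable" and u: "bdd_borel u"
  shows "integrable (lebesgue_on \<Omega>) (\<lambda>x. f x * u x)"
proof -
  obtain C where C: "\<And>x. \<bar>u x\<bar> \<le> C" using u by (auto simp: bdd_borel_def)
  have [measurable]: "f \<in> borel_measurable (lebesgue_on \<Omega>)"
    using f by (simp add: square_integrable_def)
  have [measurable]: "u \<in> borel_measurable (lebesgue_on \<Omega>)"
    using bdd_borel_integrable_lebesgue_on[OF u \<Omega>] by (rule borel_measurable_integrable)
  have "integrable (lebesgue_on \<Omega>) (\<lambda>x. C * (1 + (f x)\<^sup>2))"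
    using f bdd_borel_integrable_lebesgue_on[OF bdd_borel_const \<Omega>, of 1]
    by (simp add: square_integrable_def)
  then show ?thesis
  proof (rule Bochner_Integration.integrable_bound)
    show "AE x in lebesgue_on \<Omega>. norm (f x * u x) \<le> norm (C * (1 + (f x)\<^sup>2))"
    proof (rule AE_I2)
      fix x
      have "0 \<le> C" using C[of x] by linarith
      \<comment> \<open>\<open>\<bar>f x\<bar>\<close> is bounded by \<open>1 + (f x)\<^sup>2\<close>, which is integrable.\<close>
      have "0 \<le> (\<bar>f x\<bar> - 1)\<^sup>2" by simp
      then have "2 * \<bar>f x\<bar> \<le> 1 + (f x)\<^sup>2" by (simp add: power2_diff)
      then have "\<bar>f x\<bar> \<le> 1 + (f x)\<^sup>2" by linarith
      then have "\<bar>f x\<bar> * \<bar>u x\<bar> \<le> (1 + (f x)\<^sup>2) * C"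
        using C[of x] by (intro mult_mono) auto
      then show "norm (f x * u x) \<le> norm (C * (1 + (f x)\<^sup>2))"
        using \<open>0 \<le> C\<close> by (simp add: abs_mult mult.commute)
    qed
  qed measurable
qed

text \<open>The part of \<open>T\<close> outside \<open>\<Omega>\<close> lies in the boundary of \<open>T\<close>, a null set.\<close>

lemma ip_domain_eq_ip_element:
  assumes "negligible (frontier T)" "interior T \<subseteq> \<Omega>" "\<And>x. x \<notin> T \<Longrightarrow> u x = 0"
  shows "ip \<Omega> f u = ip T f u"
proof -
  have "AE x in lebesgue. x \<notin> frontier T"
    using assms(1) by (auto simp: eventually_ae_filter_negligible)
  then have "AE x in lebesgue. indicator \<Omega> x *\<^sub>R (f x * u x) = indicator T x *\<^sub>R (f x * u x)"
  proof (rule AE_mp, intro AE_I2 impI)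
    fix x assume "x \<notin> frontier T"
    then have "x \<in> T \<Longrightarrow> x \<in> \<Omega>" using assms(2) closure_subset by (auto simp: frontier_def)
    then show "indicator \<Omega> x *\<^sub>R (f x * u x) = indicator T x *\<^sub>R (f x * u x)"
      using assms(3)[of x] by (auto simp: indicator_def)
  qed
  then show ?thesis unfolding ip_def set_lebesgue_integral_def by (rule integral_lebesgue_cong_AE)
qed

lemma ip_broken:
  assumes f: "square_integrable (lebesgue_on \<Omega>) f" and \<Omega>: "\<Omega> \<in> lmeasurable"
    and T: "\<And>T. T \<in> Th \<Longrightarrow> negligible (frontier T)" "\<And>T. T \<in> Th \<Longrightarrow> interior T \<subseteq> \<Omega>"
    and u: "\<And>T. T \<in> Th \<Longrightarrow> bdd_borel (u T)" "\<And>T x. T \<in> Th \<Longrightarrow> x \<notin> T \<Longrightarrow> u T x = 0"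
  shows "ip \<Omega> f (broken Th u) = (\<Sum>T\<in>Th. ip T f (u T))"
proof -
  have eq: "ip \<Omega> f g = (LINT x|lebesgue_on \<Omega>. f x * g x)" for g
    using \<Omega> by (simp add: ip_def set_lebesgue_integral_def integral_restrict_space fmeasurableD)
  have "ip \<Omega> f (broken Th u) = (LINT x|lebesgue_on \<Omega>. (\<Sum>T\<in>Th. f x * u T x))"
    by (simp add: eq broken_def sum_distrib_left)
  also have "\<dots> = (\<Sum>T\<in>Th. ip \<Omega> f (u T))"
    unfolding eq by (intro Bochner_Integration.integral_sum square_integrable_times_bdd f \<Omega> u)
  also have "\<dots> = (\<Sum>T\<in>Th. ip T f (u T))"
    by (intro sum.cong refl ip_domain_eq_ip_element T u)
  finally show ?thesis .
qed

section \<open>The reduced problem\<close>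

theorem theorem3p2:
  fixes \<Omega> :: "(real^'n) set"
    and Th Eh :: "(real^'n) set set"
    and k :: nat
    and \<alpha> :: "real^'n \<Rightarrow> real^'n^'n"
    and f g :: "real^'n \<Rightarrow> real"
    and qh :: "(real^'n) set \<Rightarrow> 'n weak_field"
    and uh :: "(real^'n) set \<Rightarrow> real^'n \<Rightarrow> real"
    and lam :: "(real^'n) set \<Rightarrow> real^'n \<Rightarrow> real"
  assumes "CARD('n) = 2 \<or> CARD('n) = 3"
    and "polygonal_domain \<Omega>"
    and "admissible_coefficient \<Omega> \<alpha>"
    and "square_integrable (lebesgue_on \<Omega>) f"
    and "polytopal_mesh \<Omega> Th Eh"
    and "shape_regular Th Eh"
    and "\<And>e. e \<in> Eh \<Longrightarrow> e \<subseteq> frontier \<Omega> \<Longrightarrow> square_integrable (face_measure e) g"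
    and "hybridized_wg_solution \<Omega> Th Eh k \<alpha> f g qh uh lam"
  shows "reduced_solution \<Omega> Th Eh k \<alpha> f g lam"
proof -
  have \<Omega>: "open \<Omega>" "\<Omega> \<in> lmeasurable"
    using assms(2) lmeasurable_open by (auto simp: polygonal_domain_def)
  have elem: "mesh_element Eh T \<alpha>" if "T \<in> Th" for T
    by (rule mesh_element_of_mesh[OF assms(5) \<Omega>(1) assms(3) that])
  have sub: "interior T \<subseteq> \<Omega>" if "T \<in> Th" for T
    using assms(5) that by (simp add: polytopal_mesh_def)
  have sol: "(qh, uh) \<in> M_space Th Eh k" "lam \<in> Lambda_space Eh k"
      "\<And>e. e \<in> Eh \<Longrightarrow> e \<subseteq> frontier \<Omega> \<Longrightarrow> lam e = Qb k g e"
      "\<And>T. T \<in> Th \<Longrightarrow> flux_equation Eh k \<alpha> T lam (qh T) (uh T)"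
      "\<And>T w. T \<in> Th \<Longrightarrow> w \<in> W_space k T \<Longrightarrow> ip T (weak_div Eh k T (qh T)) w = ip T f w"
      "\<And>\<phi>. \<phi> \<in> Lambda0_space \<Omega> Eh k \<Longrightarrow> (\<Sum>T\<in>Th. bip Eh T (normal_trace T (qh T)) \<phi>) = 0"
    using assms(8) unfolding hybridized_wg_solution_def by blast+
  have bdd: "mesh_element.bdd_faces Eh T \<theta>" if "\<theta> \<in> Lambda_space Eh k" "T \<in> Th" for \<theta> T
  proof -
    interpret mesh_element Eh T k \<alpha> by (rule elem[OF that(2)])
    have "bdd_borel (\<theta> e)" if "e \<in> faces Eh T" for e
      using \<open>\<theta> \<in> Lambda_space Eh k\<close> that face_compact[OF that] polys_bdd_borel
      by (auto simp: Lambda_space_def faces_def)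
    then show ?thesis by (simp add: bdd_faces_def)
  qed
  have "(\<Sum>T\<in>Th. stab Eh T (Hq Eh k \<alpha> lam T) (Hq Eh k \<alpha> \<phi> T) +
        ipv T (\<lambda>x. \<alpha> x *v H0 Eh k \<alpha> lam T x) (H0 Eh k \<alpha> \<phi> T)) = ip \<Omega> f (broken Th (Hu Eh k \<alpha> \<phi>))"
    if \<phi>: "\<phi> \<in> Lambda0_space \<Omega> Eh k" for \<phi>
  proof -
    have \<phi>': "\<phi> \<in> Lambda_space Eh k" using \<phi> by (simp add: Lambda0_space_def)
    have "(\<Sum>T\<in>Th. stab Eh T (Hq Eh k \<alpha> lam T) (Hq Eh k \<alpha> \<phi> T) +
          ipv T (\<lambda>x. \<alpha> x *v H0 Eh k \<alpha> lam T x) (H0 Eh k \<alpha> \<phi> T)) =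
        (\<Sum>T\<in>Th. ip T f (Hu Eh k \<alpha> \<phi> T) - bip Eh T (normal_trace T (qh T)) \<phi>)"
    proof (rule sum.cong[OF refl])
      fix T assume T: "T \<in> Th"
      interpret mesh_element Eh T k \<alpha> by (rule elem[OF T])
      show "stab Eh T (Hq Eh k \<alpha> lam T) (Hq Eh k \<alpha> \<phi> T) +
          ipv T (\<lambda>x. \<alpha> x *v H0 Eh k \<alpha> lam T x) (H0 Eh k \<alpha> \<phi> T) =
        ip T f (Hu Eh k \<alpha> \<phi> T) - bip Eh T (normal_trace T (qh T)) \<phi>"
        using sol(1,5) T
        by (intro local_identity[OF bdd[OF sol(2) T] bdd[OF \<phi>' T] _ _ sol(4)[OF T]])
          (auto simp: M_space_def W_space_def)
    qed
    also have "\<dots> = (\<Sum>T\<in>Th. ip T f (Hu Eh k \<alpha> \<phi> T))"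
      using sol(6)[OF \<phi>] by (simp add: sum_subtractf)
    also have "\<dots> = ip \<Omega> f (broken Th (Hu Eh k \<alpha> \<phi>))"
    proof (rule ip_broken[OF assms(4) \<Omega>(2), symmetric])
      fix T assume T: "T \<in> Th"
      interpret mesh_element Eh T k \<alpha> by (rule elem[OF T])
      have "Hu Eh k \<alpha> \<phi> T \<in> W"
        using H_local_solution[OF bdd[OF \<phi>' T]] by (simp add: local_solution_def)
      then show "bdd_borel (Hu Eh k \<alpha> \<phi> T)" "\<And>x. x \<notin> T \<Longrightarrow> Hu Eh k \<alpha> \<phi> T x = 0"
        using W_bdd polys_outside by blast+
      show "negligible (frontier T)" by (rule T_frontier)
      show "interior T \<subseteq> \<Omega>" by (rule sub[OF T])
    qed
    finally show ?thesis .
  qed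
  then show ?thesis using sol(2,3) by (simp add: reduced_solution_def)
qed

end
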